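(* Let $G$ be an affine reductive algebraic group over $\mathbb C$, let $H$ be a finite central subgroup of $G$, and let $F_N$ be the free group of rank $N$. The projection $G\to G/H$ induces an isomorphism $$\psi:\ X_G(F_N)/H^N\to X_{G/H}(F_N).$$
   Context: For an affine reductive algebraic group $G$ over $\mathbb C$, $Hom(F_N,G)=G^N$ (a representation is identified with the tuple of images of free generators $\gamma_1,\dots,\gamma_N$), $G$ acts on it by simultaneous conjugation, and $X_G(F_N)=G^N//G$ is the categorical quotient. The finite group $H^N=Hom(F_N,H)$ acts on $Hom(F_N,G)=G^N$ by multiplication, $(\sigma\cdot\rho)(\gamma)=\sigma(\gamma)\rho(\gamma)$; this commutes with conjugation and so induces an action on $X_G(F_N)$. The quotient by this finite group is both a set-theoretic and a categorical quotient. Isomorphism means isomorphism of algebraic sets. *)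

theory Defs
  imports "HOL-Analysis.Analysis" "HOL-Algebra.Coset"
begin

section \<open>Affine algebraic sets over the complex numbers\<close>

text \<open>A set of points together with its regular functions. HOL functions are total, so
  \<open>reg V\<close> is meant to contain every function that agrees with a regular function on the
  points of \<open>V\<close>; its values outside \<open>carrier V\<close> are irrelevant.\<close>

record 'a alg_set = "'a partial_object" +
  reg :: "('a \<Rightarrow> complex) set"

text \<open>The algebra of functions on \<open>X\<close> generated by \<open>F\<close> and the constants.\<close>

inductive_set fun_alg :: "'a set \<Rightarrow> ('a \<Rightarrow> complex) set \<Rightarrow> ('a \<Rightarrow> complex) set"
  for X :: "'a set" and F :: "('a \<Rightarrow> complex) set" where
  gen: "f \<in> F \<Longrightarrow> f \<in> fun_alg X F"
| const: "(\<lambda>_. c) \<in> fun_alg X F"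
| add: "f \<in> fun_alg X F \<Longrightarrow> g \<in> fun_alg X F \<Longrightarrow> (\<lambda>x. f x + g x) \<in> fun_alg X F"
| mult: "f \<in> fun_alg X F \<Longrightarrow> g \<in> fun_alg X F \<Longrightarrow> (\<lambda>x. f x * g x) \<in> fun_alg X F"
| cong: "f \<in> fun_alg X F \<Longrightarrow> (\<And>x. x \<in> X \<Longrightarrow> g x = f x) \<Longrightarrow> g \<in> fun_alg X F"

definition affine_space :: "nat \<Rightarrow> (nat \<Rightarrow> complex) set" where
  "affine_space n = {..<n} \<rightarrow>\<^sub>E UNIV"

definition poly_funs :: "nat \<Rightarrow> ((nat \<Rightarrow> complex) \<Rightarrow> complex) set" where
  "poly_funs n = fun_alg (affine_space n) {\<lambda>x. x i | i. i < n}"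

definition algebraic_subset :: "nat \<Rightarrow> (nat \<Rightarrow> complex) set \<Rightarrow> bool" where
  "algebraic_subset n S \<longleftrightarrow>
     (\<exists>P \<subseteq> poly_funs n. S = {x \<in> affine_space n. \<forall>p\<in>P. p x = 0})"

text \<open>Up to the choice of an embedding \<open>e\<close>, a Zariski closed subset of some affine space with
  the restrictions of the polynomial functions.\<close>

definition affine_alg_set :: "'a alg_set \<Rightarrow> bool" where
  "affine_alg_set V \<longleftrightarrow>
     (\<exists>n S e. algebraic_subset n S \<and> bij_betw e (carrier V) S \<and>
        reg V = {f. \<exists>p\<in>poly_funs n. \<forall>x\<in>carrier V. f x = p (e x)})"

definition morphism :: "'a alg_set \<Rightarrow> 'b alg_set \<Rightarrow> ('a \<Rightarrow> 'b) \<Rightarrow> bool" where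
  "morphism V W f \<longleftrightarrow> f \<in> carrier V \<rightarrow> carrier W \<and> (\<forall>h\<in>reg W. h \<circ> f \<in> reg V)"

definition isomorphism :: "'a alg_set \<Rightarrow> 'b alg_set \<Rightarrow> ('a \<Rightarrow> 'b) \<Rightarrow> bool" where
  "isomorphism V W f \<longleftrightarrow> morphism V W f \<and>
     (\<exists>g. morphism W V g \<and> (\<forall>x\<in>carrier V. g (f x) = x) \<and> (\<forall>y\<in>carrier W. f (g y) = y))"

definition prod_alg_set :: "'a alg_set \<Rightarrow> 'b alg_set \<Rightarrow> ('a \<times> 'b) alg_set" where
  "prod_alg_set V W =
     \<lparr>carrier = carrier V \<times> carrier W,
      reg = fun_alg (carrier V \<times> carrier W) ({f \<circ> fst | f. f \<in> reg V} \<union> {g \<circ> snd | g. g \<in> reg W})\<rparr>"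

definition power_alg_set :: "nat \<Rightarrow> 'a alg_set \<Rightarrow> (nat \<Rightarrow> 'a) alg_set" where
  "power_alg_set N V =
     \<lparr>carrier = {..<N} \<rightarrow>\<^sub>E carrier V,
      reg = fun_alg ({..<N} \<rightarrow>\<^sub>E carrier V) {\<lambda>x. f (x i) | f i. f \<in> reg V \<and> i < N}\<rparr>"

text \<open>The set-theoretic quotient along \<open>p\<close>: a function on it is regular iff its pullback is.\<close>

definition quotient_alg_set :: "'a alg_set \<Rightarrow> ('a \<Rightarrow> 'b) \<Rightarrow> 'b alg_set" where
  "quotient_alg_set V p = \<lparr>carrier = p ` carrier V, reg = {f. f \<circ> p \<in> reg V}\<rparr>"

definition zariski :: "'a alg_set \<Rightarrow> 'a topology" where
  "zariski V = topology_generated_by {{x \<in> carrier V. f x \<noteq> 0} | f. f \<in> reg V}"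


section \<open>Affine algebraic groups\<close>

record 'a alg_group = "'a monoid" +
  greg :: "('a \<Rightarrow> complex) set"

definition var :: "'a alg_group \<Rightarrow> 'a alg_set" where
  "var G = \<lparr>carrier = carrier G, reg = greg G\<rparr>"

definition affine_alg_group :: "'a alg_group \<Rightarrow> bool" where
  "affine_alg_group G \<longleftrightarrow> group G \<and> affine_alg_set (var G) \<and>
     morphism (prod_alg_set (var G) (var G)) (var G) (\<lambda>(x, y). x \<otimes>\<^bsub>G\<^esub> y) \<and>
     morphism (var G) (var G) (\<lambda>x. inv\<^bsub>G\<^esub> x)"

text \<open>An element \<open>u\<close> is unipotent iff right translation by \<open>u\<close> is a locally unipotent operator on
  the coordinate ring.\<close>

definition unipotent :: "'a alg_group \<Rightarrow> 'a \<Rightarrow> bool" where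
  "unipotent G u \<longleftrightarrow> u \<in> carrier G \<and>
     (\<forall>f\<in>greg G. \<exists>n. \<forall>x\<in>carrier G. ((\<lambda>h y. h (y \<otimes>\<^bsub>G\<^esub> u) - h y) ^^ n) f x = 0)"

text \<open>Trivial unipotent radical. Connectedness of the group is not required.\<close>

definition reductive_group :: "'a alg_group \<Rightarrow> bool" where
  "reductive_group G \<longleftrightarrow> affine_alg_group G \<and>
     (\<forall>U. U \<lhd> G \<and> closedin (zariski (var G)) U \<and> connectedin (zariski (var G)) U \<and>
          (\<forall>u\<in>U. unipotent G u) \<longrightarrow> U = {\<one>\<^bsub>G\<^esub>})"

text \<open>The quotient by a finite normal subgroup; its coordinate ring consists of the functions
  on the cosets that pull back to regular functions on the group.\<close>

definition quotient_group :: "'a alg_group \<Rightarrow> 'a set \<Rightarrow> 'a set alg_group" where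
  "quotient_group G H =
     \<lparr>carrier = carrier (G Mod H), mult = mult (G Mod H), one = one (G Mod H),
      greg = reg (quotient_alg_set (var G) (\<lambda>g. H #>\<^bsub>G\<^esub> g))\<rparr>"


section \<open>Categorical quotients\<close>

text \<open>\<open>p : V \<rightarrow> Q\<close> is a categorical quotient of \<open>V\<close> by the action \<open>act\<close> of \<open>K\<close>, in the category of
  affine algebraic sets. Every affine algebraic set is isomorphic to a closed subset of some
  affine space, so it is enough to test with targets \<open>Z\<close> on the type \<^typ>\<open>nat \<Rightarrow> complex\<close>.\<close>

definition invariant_on :: "'k set \<Rightarrow> ('k \<Rightarrow> 'a \<Rightarrow> 'a) \<Rightarrow> 'a set \<Rightarrow> ('a \<Rightarrow> 'b) \<Rightarrow> bool" where
  "invariant_on K act A f \<longleftrightarrow> (\<forall>k\<in>K. \<forall>x\<in>A. f (act k x) = f x)"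

definition categorical_quotient ::
  "'k set \<Rightarrow> ('k \<Rightarrow> 'a \<Rightarrow> 'a) \<Rightarrow> 'a alg_set \<Rightarrow> 'q alg_set \<Rightarrow> ('a \<Rightarrow> 'q) \<Rightarrow> bool" where
  "categorical_quotient K act V Q p \<longleftrightarrow>
     affine_alg_set Q \<and> morphism V Q p \<and> invariant_on K act (carrier V) p \<and>
     (\<forall>(Z :: (nat \<Rightarrow> complex) alg_set) f.
        affine_alg_set Z \<and> morphism V Z f \<and> invariant_on K act (carrier V) f \<longrightarrow>
        (\<exists>!h. h \<in> extensional (carrier Q) \<and> morphism Q Z h \<and> (\<forall>x\<in>carrier V. h (p x) = f x)))"

text \<open>\<open>h : P \<rightarrow> Q\<close> is induced by \<open>f : V \<rightarrow> W\<close>, that is, \<open>h \<circ> p = q \<circ> f\<close> for the projections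
  \<open>p : V \<rightarrow> P\<close> and \<open>q : W \<rightarrow> Q\<close>.\<close>

definition induced ::
  "'a alg_set \<Rightarrow> ('a \<Rightarrow> 'p) \<Rightarrow> 'p alg_set \<Rightarrow> ('b \<Rightarrow> 'q) \<Rightarrow> 'q alg_set \<Rightarrow> ('a \<Rightarrow> 'b) \<Rightarrow> ('p \<Rightarrow> 'q) \<Rightarrow> bool"
where
  "induced V p P q Q f h \<longleftrightarrow> h \<in> extensional (carrier P) \<and> morphism P Q h \<and>
     (\<forall>x\<in>carrier V. h (p x) = q (f x))"


section \<open>Character varieties of free groups\<close>

text \<open>A representation of the free group of rank \<open>N\<close> is identified with the tuple of the images
  of the free generators, indexed by \<open>{..<N}\<close>.\<close>

definition hom_free :: "nat \<Rightarrow> 'a alg_group \<Rightarrow> (nat \<Rightarrow> 'a) alg_set" where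
  "hom_free N G = power_alg_set N (var G)"

definition conj_tuple :: "nat \<Rightarrow> 'a alg_group \<Rightarrow> 'a \<Rightarrow> (nat \<Rightarrow> 'a) \<Rightarrow> nat \<Rightarrow> 'a" where
  "conj_tuple N G g \<rho> = (\<lambda>i\<in>{..<N}. g \<otimes>\<^bsub>G\<^esub> \<rho> i \<otimes>\<^bsub>G\<^esub> inv\<^bsub>G\<^esub> g)"

definition character_variety ::
  "nat \<Rightarrow> 'a alg_group \<Rightarrow> 'x alg_set \<Rightarrow> ((nat \<Rightarrow> 'a) \<Rightarrow> 'x) \<Rightarrow> bool" where
  "character_variety N G X \<pi> \<longleftrightarrow>
     categorical_quotient (carrier G) (conj_tuple N G) (hom_free N G) X \<pi>"

definition mult_tuple :: "nat \<Rightarrow> 'a alg_group \<Rightarrow> (nat \<Rightarrow> 'a) \<Rightarrow> (nat \<Rightarrow> 'a) \<Rightarrow> nat \<Rightarrow> 'a" where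
  "mult_tuple N G \<sigma> \<rho> = (\<lambda>i\<in>{..<N}. \<sigma> i \<otimes>\<^bsub>G\<^esub> \<rho> i)"

text \<open>The action of a tuple \<open>\<sigma>\<close> of central elements on a character variety. The universal
  property of \<open>\<pi>\<close> makes the induced morphism exist uniquely.\<close>

definition char_act ::
  "nat \<Rightarrow> 'a alg_group \<Rightarrow> 'x alg_set \<Rightarrow> ((nat \<Rightarrow> 'a) \<Rightarrow> 'x) \<Rightarrow> (nat \<Rightarrow> 'a) \<Rightarrow> 'x \<Rightarrow> 'x" where
  "char_act N G X \<pi> \<sigma> = (THE h. induced (hom_free N G) \<pi> X \<pi> X (mult_tuple N G \<sigma>) h)"

definition char_orbit ::
  "nat \<Rightarrow> 'a alg_group \<Rightarrow> 'a set \<Rightarrow> 'x alg_set \<Rightarrow> ((nat \<Rightarrow> 'a) \<Rightarrow> 'x) \<Rightarrow> 'x \<Rightarrow> 'x set" where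
  "char_orbit N G H X \<pi> x = (\<lambda>\<sigma>. char_act N G X \<pi> \<sigma> x) ` ({..<N} \<rightarrow>\<^sub>E H)"

definition char_orbit_space ::
  "nat \<Rightarrow> 'a alg_group \<Rightarrow> 'a set \<Rightarrow> 'x alg_set \<Rightarrow> ((nat \<Rightarrow> 'a) \<Rightarrow> 'x) \<Rightarrow> 'x set alg_set" where
  "char_orbit_space N G H X \<pi> = quotient_alg_set X (char_orbit N G H X \<pi>)"

definition proj_tuple :: "nat \<Rightarrow> 'a alg_group \<Rightarrow> 'a set \<Rightarrow> (nat \<Rightarrow> 'a) \<Rightarrow> nat \<Rightarrow> 'a set" where
  "proj_tuple N G H \<rho> = (\<lambda>i\<in>{..<N}. H #>\<^bsub>G\<^esub> \<rho> i)"

end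

theory Submission
  imports Defs "HOL-Algebra.Product_Groups" "HOL-Computational_Algebra.Fundamental_Theorem_Algebra"
begin

text \<open>The two sides have the same coordinate ring. By the universal property, the regular functions
  on a categorical quotient are the invariant regular functions
  (\<open>categorical_quotient_function_lift\<close>, \<open>categorical_quotient_function_eq\<close>). Averaging over \<open>H\<close> in
  each coordinate shows that the functions on \<open>(G/H)\<^sup>N\<close> are the \<open>H\<^sup>N\<close>-invariant functions on \<open>G\<^sup>N\<close>
  (\<open>translation_invariant_descends\<close>). The actions of \<open>H\<^sup>N\<close> and of conjugation commute, so
  \<open>C[Y] = C[(G/H)^N]^{G/H} = (C[G^N]^{H^N})^G = (C[G^N]^G)^{H^N} = C[X]^{H^N}\<close>,
  where the isomorphism is pullback along the morphism \<open>h : X \<rightarrow> Y\<close> induced by \<open>G\<^sup>N \<rightarrow> (G/H)\<^sup>N\<close>.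

  It remains to pass from coordinate rings to points, which is a general fact about a finite group
  \<open>K\<close> acting on an affine algebraic set \<open>X\<close>: if pullback along \<open>h : X \<rightarrow> Y\<close> identifies \<open>C[Y]\<close> with
  \<open>C[X]\<^sup>K\<close>, then \<open>h\<close> is the quotient by \<open>K\<close> also on points (\<open>orbit_space_isomorphism\<close>). The fibres of
  \<open>h\<close> are the orbits because norms separate orbits (\<open>fibres_are_orbits\<close>). Surjectivity is lying over for
  the integral extension \<open>C[X]\<close> of \<open>C[X]\<^sup>K\<close> (\<open>surjective\<close>): the functions vanishing at a point of \<open>Y\<close>
  generate a proper ideal of \<open>C[X]\<close>, as one sees by averaging, and modulo this ideal every function is
  a root of a polynomial with complex coefficients. For such an ideal a zero is found by choosing roots
  for the coordinates one by one (\<open>integral_ideal_has_zero\<close>).\<close>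


section \<open>Algebras of regular functions\<close>

text \<open>The closure properties that \<open>reg\<close> has for affine algebraic sets and for their powers. The last
one reflects that values outside the carrier do not matter.\<close>

locale function_algebra =
  fixes V :: "'a alg_set"
  assumes const: "(\<lambda>_. c) \<in> reg V"
    and add: "f \<in> reg V \<Longrightarrow> g \<in> reg V \<Longrightarrow> (\<lambda>x. f x + g x) \<in> reg V"
    and mult: "f \<in> reg V \<Longrightarrow> g \<in> reg V \<Longrightarrow> (\<lambda>x. f x * g x) \<in> reg V"
    and reg_cong: "f \<in> reg V \<Longrightarrow> (\<And>x. x \<in> carrier V \<Longrightarrow> g x = f x) \<Longrightarrow> g \<in> reg V"
begin

lemma scale: "f \<in> reg V \<Longrightarrow> (\<lambda>x. c * f x) \<in> reg V"
  using mult[OF const] by blast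

lemma diff: "f \<in> reg V \<Longrightarrow> g \<in> reg V \<Longrightarrow> (\<lambda>x. f x - g x) \<in> reg V"
  using add[OF _ scale[of g "-1"], of f] by simp

lemma sum: "(\<And>i. i \<in> I \<Longrightarrow> f i \<in> reg V) \<Longrightarrow> (\<lambda>x. \<Sum>i\<in>I. f i x) \<in> reg V"
  by (induction I rule: infinite_finite_induct) (simp_all add: const add)

lemma prod: "(\<And>i. i \<in> I \<Longrightarrow> f i \<in> reg V) \<Longrightarrow> (\<lambda>x. \<Prod>i\<in>I. f i x) \<in> reg V"
  by (induction I rule: infinite_finite_induct) (simp_all add: const mult)

lemma power: "f \<in> reg V \<Longrightarrow> (\<lambda>x. f x ^ m) \<in> reg V"
  by (induction m) (simp_all add: const mult)

lemma poly: "f \<in> reg V \<Longrightarrow> (\<lambda>x. poly q (f x)) \<in> reg V"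
  by (simp add: poly_altdef sum scale power)

text \<open>A pullback needs to be checked for regularity on generators only.\<close>

lemma fun_alg_compose:
  assumes "f \<in> fun_alg Y F" and "\<And>x. x \<in> carrier V \<Longrightarrow> e x \<in> Y"
    and "\<And>f. f \<in> F \<Longrightarrow> (\<lambda>x. f (e x)) \<in> reg V"
  shows "(\<lambda>x. f (e x)) \<in> reg V"
  using assms(1)
proof induction
  case (cong f g)
  show ?case
    by (rule reg_cong[OF cong.IH]) (use cong.hyps assms(2) in auto)
qed (auto intro: assms(3) const add mult)

end

lemma function_algebra_fun_alg: "function_algebra \<lparr>carrier = A, reg = fun_alg A F\<rparr>"
  by unfold_locales (auto intro: fun_alg.intros)

lemma poly_funs_compose:
  assumes "function_algebra V" and "p \<in> poly_funs n"
    and "\<And>x. x \<in> carrier V \<Longrightarrow> e x \<in> affine_space n"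
    and "\<And>i. i < n \<Longrightarrow> (\<lambda>x. e x i) \<in> reg V"
  shows "(\<lambda>x. p (e x)) \<in> reg V"
  by (rule function_algebra.fun_alg_compose[OF assms(1) assms(2)[unfolded poly_funs_def]])
     (use assms(3,4) in auto)

lemma coordinate_in_poly_funs: "i < n \<Longrightarrow> (\<lambda>x. x i) \<in> poly_funs n"
  unfolding poly_funs_def by (rule fun_alg.gen) auto

lemma affine_alg_setE:
  assumes "affine_alg_set V"
  obtains n P e where "P \<subseteq> poly_funs n"
    "bij_betw e (carrier V) {x \<in> affine_space n. \<forall>p\<in>P. p x = 0}"
    "reg V = {f. \<exists>p\<in>poly_funs n. \<forall>x\<in>carrier V. f x = p (e x)}"
  using assms unfolding affine_alg_set_def algebraic_subset_def by auto

lemma affine_function_algebra: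
  assumes "affine_alg_set V"
  shows "function_algebra V"
proof -
  obtain n P e where reg: "reg V = {f. \<exists>p\<in>poly_funs n. \<forall>x\<in>carrier V. f x = p (e x)}"
    using assms by (rule affine_alg_setE)
  show ?thesis
  proof
    show "(\<lambda>_. c) \<in> reg V" for c
      unfolding reg poly_funs_def by (auto intro!: bexI[OF _ fun_alg.const])
    show "(\<lambda>x. f x + g x) \<in> reg V" if "f \<in> reg V" "g \<in> reg V" for f g
      using that unfolding reg poly_funs_def by (force intro: fun_alg.add)
    show "(\<lambda>x. f x * g x) \<in> reg V" if "f \<in> reg V" "g \<in> reg V" for f g
      using that unfolding reg poly_funs_def by (force intro: fun_alg.mult)
    show "g \<in> reg V" if "f \<in> reg V" "\<And>x. x \<in> carrier V \<Longrightarrow> g x = f x" for f g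
      using that unfolding reg by auto
  qed
qed

text \<open>The coordinates of an embedding into affine space are regular. A point is therefore determined
by the values of the regular functions, which is how equality of points is proved below.\<close>

lemma affine_separates_points:
  assumes "affine_alg_set V" "x \<in> carrier V" "y \<in> carrier V"
    and eq: "\<And>f. f \<in> reg V \<Longrightarrow> f x = f y"
  shows "x = y"
proof -
  obtain n P e where "P \<subseteq> poly_funs n"
    and bij: "bij_betw e (carrier V) {x \<in> affine_space n. \<forall>p\<in>P. p x = 0}"
    and reg: "reg V = {f. \<exists>p\<in>poly_funs n. \<forall>x\<in>carrier V. f x = p (e x)}"
    using assms(1) by (rule affine_alg_setE)
  have e: "e x \<in> affine_space n" "e y \<in> affine_space n"
    using bij_betwE[OF bij] assms by auto
  have "e x i = e y i" if "i < n" for i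
  proof (rule eq)
    show "(\<lambda>v. e v i) \<in> reg V"
      unfolding reg by (intro CollectI bexI[OF _ coordinate_in_poly_funs[OF that]]) simp
  qed
  then have "e x = e y"
    using e unfolding affine_space_def by (intro PiE_ext) auto
  then show ?thesis
    using bij assms unfolding bij_betw_def inj_on_def by auto
qed

lemma morphism_regular: "morphism V W f \<Longrightarrow> g \<in> reg W \<Longrightarrow> (\<lambda>x. g (f x)) \<in> reg V"
  unfolding morphism_def comp_def by auto

lemma morphism_closed: "morphism V W f \<Longrightarrow> x \<in> carrier V \<Longrightarrow> f x \<in> carrier W"
  unfolding morphism_def by auto

lemma morphismI:
  "(\<And>x. x \<in> carrier V \<Longrightarrow> f x \<in> carrier W) \<Longrightarrow> (\<And>g. g \<in> reg W \<Longrightarrow> (\<lambda>x. g (f x)) \<in> reg V)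
    \<Longrightarrow> morphism V W f"
  unfolding morphism_def comp_def by auto

lemma morphism_compose:
  "morphism V W f \<Longrightarrow> morphism W Z g \<Longrightarrow> morphism V Z (\<lambda>x. g (f x))"
  by (intro morphismI) (auto dest: morphism_closed morphism_regular)

lemma morphism_cong:
  assumes "function_algebra V" "morphism V W f" "\<And>x. x \<in> carrier V \<Longrightarrow> g x = f x"
  shows "morphism V W g"
proof (rule morphismI)
  show "g x \<in> carrier W" if "x \<in> carrier V" for x
    using that assms morphism_closed by fastforce
  show "(\<lambda>x. h (g x)) \<in> reg V" if "h \<in> reg W" for h
    by (rule function_algebra.reg_cong[OF assms(1) morphism_regular[OF assms(2) that]])
       (simp add: assms(3))
qed

text \<open>The universal property of a categorical quotient is tested against targets on the type
\<open>nat \<Rightarrow> complex\<close> only. This isomorphic copy of \<open>W\<close> makes it available for targets on any type.\<close>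

lemma affine_embedding:
  assumes "affine_alg_set W"
  obtains Z :: "(nat \<Rightarrow> complex) alg_set" and e e'
  where "affine_alg_set Z" "morphism W Z e" "morphism Z W e'" "\<And>x. x \<in> carrier W \<Longrightarrow> e' (e x) = x"
proof -
  obtain n P e where P: "P \<subseteq> poly_funs n"
    and bij: "bij_betw e (carrier W) {x \<in> affine_space n. \<forall>p\<in>P. p x = 0}"
    and reg: "reg W = {f. \<exists>p\<in>poly_funs n. \<forall>x\<in>carrier W. f x = p (e x)}"
    using assms by (rule affine_alg_setE)
  define S where "S = {x \<in> affine_space n. \<forall>p\<in>P. p x = 0}"
  define Z where "Z = \<lparr>carrier = S, reg = {f. \<exists>p\<in>poly_funs n. \<forall>x\<in>S. f x = p x}\<rparr>"
  define e' where "e' = inv_into (carrier W) e"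
  have bijS: "bij_betw e (carrier W) S" using bij S_def by simp
  have e': "e' (e x) = x" if "x \<in> carrier W" for x
    using bijS that unfolding e'_def bij_betw_def by auto
  have e'c: "e' z \<in> carrier W" "e (e' z) = z" if "z \<in> S" for z
    using bijS that unfolding e'_def bij_betw_def
    by (auto intro: inv_into_into f_inv_into_f)
  show ?thesis
  proof
    have "algebraic_subset n S"
      unfolding algebraic_subset_def S_def using P by auto
    moreover have "bij_betw id (carrier Z) S" by (simp add: Z_def)
    ultimately show "affine_alg_set Z"
      unfolding affine_alg_set_def by (intro exI[of _ n] exI[of _ S] exI[of _ id]) (auto simp: Z_def)
    show "morphism W Z e"
      by (rule morphismI) (use bijS in \<open>auto simp: Z_def reg bij_betw_def\<close>)
    show "morphism Z W e'"
      by (rule morphismI) (use e'c in \<open>auto simp: Z_def reg\<close>)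
  qed (rule e')
qed


section \<open>Categorical quotients and invariant functions\<close>

text \<open>Regular functions are morphisms to the affine line. Applied to this target, the universal
property says that pullback along \<open>p\<close> is a bijection from the regular functions on the quotient to
the invariant regular functions: existence gives surjectivity of the pullback and uniqueness gives
injectivity.\<close>

definition affine_line :: "(nat \<Rightarrow> complex) alg_set" where
  "affine_line = \<lparr>carrier = affine_space 1, reg = poly_funs 1\<rparr>"

lemma affine_affine_line: "affine_alg_set affine_line"
proof -
  have "algebraic_subset 1 (affine_space 1)"
    unfolding algebraic_subset_def by (intro exI[of _ "{}"]) auto
  moreover have "poly_funs 1 = {f. \<exists>p\<in>poly_funs 1. \<forall>x\<in>affine_space 1. f x = p x}"
    unfolding poly_funs_def by (auto intro: fun_alg.cong)
  ultimately show ?thesis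
    unfolding affine_alg_set_def
    by (intro exI[of _ 1] exI[of _ "affine_space 1"] exI[of _ id]) (simp add: affine_line_def)
qed

lemma morphism_to_affine_line:
  assumes "function_algebra V" "f \<in> reg V"
  shows "morphism V affine_line (\<lambda>x. \<lambda>i\<in>{..<1}. f x)"
proof (rule morphismI)
  show "(\<lambda>x. g (\<lambda>i\<in>{..<1}. f x)) \<in> reg V" if "g \<in> reg affine_line" for g
  proof (rule poly_funs_compose[OF assms(1), where n = 1 and e = "\<lambda>x. \<lambda>i\<in>{..<1::nat}. f x"])
    show "g \<in> poly_funs 1" using that by (simp add: affine_line_def)
    show "(\<lambda>x. (\<lambda>i\<in>{..<1}. f x) i) \<in> reg V" if "i < 1" for i :: nat
      using that assms(2) by simp
  qed (simp add: affine_space_def)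
qed (simp add: affine_line_def affine_space_def)

lemma categorical_quotient_function_lift:
  assumes q: "categorical_quotient K act V Q p" and V: "function_algebra V"
    and f: "f \<in> reg V" "invariant_on K act (carrier V) f"
  obtains g where "g \<in> reg Q" "\<And>x. x \<in> carrier V \<Longrightarrow> g (p x) = f x"
proof -
  let ?f = "\<lambda>x. \<lambda>i\<in>{..<1::nat}. f x"
  have "invariant_on K act (carrier V) ?f"
    using f(2) unfolding invariant_on_def by simp
  then have "\<exists>!h. h \<in> extensional (carrier Q) \<and> morphism Q affine_line h \<and>
      (\<forall>x\<in>carrier V. h (p x) = ?f x)"
    using q affine_affine_line morphism_to_affine_line[OF V f(1)]
    unfolding categorical_quotient_def by blast
  then obtain h where h: "morphism Q affine_line h" "\<forall>x\<in>carrier V. h (p x) = ?f x"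
    by blast
  show ?thesis
  proof
    show "(\<lambda>x. h x 0) \<in> reg Q"
      by (rule morphism_regular[OF h(1)]) (simp add: affine_line_def coordinate_in_poly_funs)
    show "h (p x) 0 = f x" if "x \<in> carrier V" for x
      using h(2) that by simp
  qed
qed

text \<open>Both functions, viewed as maps to the affine line, factor the same invariant map. For functions
on \<open>Q\<close> the image of \<open>p\<close> is thus as good as all of \<open>Q\<close>.\<close>

lemma categorical_quotient_function_eq:
  fixes Q :: "'q alg_set"
  assumes q: "categorical_quotient K act V Q p" and V: "function_algebra V"
    and g: "g1 \<in> reg Q" "g2 \<in> reg Q" "\<And>x. x \<in> carrier V \<Longrightarrow> g1 (p x) = g2 (p x)"
    and y: "y \<in> carrier Q"
  shows "g1 y = g2 y"
proof -
  have Q: "function_algebra Q" and p: "morphism V Q p" and inv: "invariant_on K act (carrier V) p"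
    using q affine_function_algebra unfolding categorical_quotient_def by auto
  define f where "f = (\<lambda>x. \<lambda>i\<in>{..<1::nat}. g1 (p x))"
  define h where "h g = (\<lambda>y\<in>carrier Q. \<lambda>i\<in>{..<1::nat}. g y)" for g :: "'q \<Rightarrow> complex"
  have "morphism V affine_line f"
    unfolding f_def by (rule morphism_to_affine_line[OF V morphism_regular[OF p g(1)]])
  moreover have "invariant_on K act (carrier V) f"
    using inv unfolding f_def invariant_on_def by simp
  ultimately have "\<exists>!h. h \<in> extensional (carrier Q) \<and> morphism Q affine_line h \<and>
      (\<forall>x\<in>carrier V. h (p x) = f x)"
    using q affine_affine_line unfolding categorical_quotient_def by blast
  moreover have "h g \<in> extensional (carrier Q) \<and> morphism Q affine_line (h g)" if "g \<in> reg Q" for g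
    by (simp add: h_def morphism_cong[OF Q morphism_to_affine_line[OF Q that]])
  moreover have "\<forall>x\<in>carrier V. h g1 (p x) = f x" "\<forall>x\<in>carrier V. h g2 (p x) = f x"
    using g(3) morphism_closed[OF p] by (auto simp: h_def f_def)
  ultimately have "h g1 = h g2" using g(1,2) by blast
  then have "h g1 y 0 = h g2 y 0" by simp
  then show ?thesis using y by (simp add: h_def)
qed

lemma categorical_quotient_morphism_eq:
  assumes q: "categorical_quotient K act V Q p" and V: "function_algebra V"
    and W: "affine_alg_set W" and h: "morphism Q W h1" "morphism Q W h2"
    and eq: "\<And>x. x \<in> carrier V \<Longrightarrow> h1 (p x) = h2 (p x)" and y: "y \<in> carrier Q"
  shows "h1 y = h2 y"
proof (rule affine_separates_points[OF W])
  show "f (h1 y) = f (h2 y)" if "f \<in> reg W" for f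
  proof (rule categorical_quotient_function_eq[OF q V _ _ _ y, of "\<lambda>y. f (h1 y)" "\<lambda>y. f (h2 y)"])
  qed (use that h eq in \<open>auto intro: morphism_regular\<close>)
qed (use h y in \<open>auto intro: morphism_closed\<close>)

lemma categorical_quotient_morphism_lift:
  assumes q: "categorical_quotient K act V Q p" and W: "affine_alg_set W"
    and f: "morphism V W f" "invariant_on K act (carrier V) f"
  obtains h where "h \<in> extensional (carrier Q)" "morphism Q W h"
    "\<And>x. x \<in> carrier V \<Longrightarrow> h (p x) = f x"
proof -
  have Q: "function_algebra Q" and p: "morphism V Q p"
    using q affine_function_algebra unfolding categorical_quotient_def by auto
  obtain Z :: "(nat \<Rightarrow> complex) alg_set" and e e'
    where Z: "affine_alg_set Z" and e: "morphism W Z e" "morphism Z W e'"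
      "\<And>x. x \<in> carrier W \<Longrightarrow> e' (e x) = x"
    using W by (rule affine_embedding) blast
  have "invariant_on K act (carrier V) (\<lambda>x. e (f x))"
    using f(2) unfolding invariant_on_def by simp
  then have "\<exists>!h. h \<in> extensional (carrier Q) \<and> morphism Q Z h \<and>
      (\<forall>x\<in>carrier V. h (p x) = e (f x))"
    using q Z morphism_compose[OF f(1) e(1)] unfolding categorical_quotient_def by blast
  then obtain h where h: "morphism Q Z h" "\<forall>x\<in>carrier V. h (p x) = e (f x)"
    by blast
  show ?thesis
  proof
    show "restrict (\<lambda>y. e' (h y)) (carrier Q) \<in> extensional (carrier Q)" by simp
    show "morphism Q W (restrict (\<lambda>y. e' (h y)) (carrier Q))"
      by (rule morphism_cong[OF Q morphism_compose[OF h(1) e(2)]]) simp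
    show "restrict (\<lambda>y. e' (h y)) (carrier Q) (p x) = f x" if "x \<in> carrier V" for x
      using that h(2) e(3) morphism_closed[OF p] morphism_closed[OF f(1)] by simp
  qed
qed


section \<open>A Nullstellensatz for integral coordinates\<close>

text \<open>An ideal of the algebra of functions on the points of \<open>V\<close>. Closure under changes outside the
carrier lets it be handled as a set of total functions.\<close>

definition (in function_algebra) function_ideal :: "('a \<Rightarrow> complex) set \<Rightarrow> bool" where
  "function_ideal I \<longleftrightarrow> I \<subseteq> reg V \<and> (\<lambda>_. 0) \<in> I \<and>
     (\<forall>f\<in>I. \<forall>g\<in>I. (\<lambda>x. f x + g x) \<in> I) \<and> (\<forall>a\<in>reg V. \<forall>f\<in>I. (\<lambda>x. a x * f x) \<in> I) \<and>
     (\<forall>f\<in>I. \<forall>g. (\<forall>x\<in>carrier V. g x = f x) \<longrightarrow> g \<in> I)"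

context function_algebra
begin

lemma ideal_reg: "function_ideal I \<Longrightarrow> f \<in> I \<Longrightarrow> f \<in> reg V"
  and ideal_zero: "function_ideal I \<Longrightarrow> (\<lambda>_. 0) \<in> I"
  and ideal_add: "function_ideal I \<Longrightarrow> f \<in> I \<Longrightarrow> g \<in> I \<Longrightarrow> (\<lambda>x. f x + g x) \<in> I"
  and ideal_mult: "function_ideal I \<Longrightarrow> a \<in> reg V \<Longrightarrow> f \<in> I \<Longrightarrow> (\<lambda>x. a x * f x) \<in> I"
  and ideal_cong: "function_ideal I \<Longrightarrow> f \<in> I \<Longrightarrow> (\<And>x. x \<in> carrier V \<Longrightarrow> g x = f x) \<Longrightarrow> g \<in> I"
  unfolding function_ideal_def by blast+

lemma ideal_diff: "function_ideal I \<Longrightarrow> f \<in> I \<Longrightarrow> g \<in> I \<Longrightarrow> (\<lambda>x. f x - g x) \<in> I"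
  using ideal_add[OF _ _ ideal_mult[OF _ const[of "-1"], of I g], of f] by simp

text \<open>If \<open>q(a)\<close> lies in a proper ideal, then some root \<open>c\<close> of \<open>q\<close> can be taken as the value of \<open>a\<close>:
since the product of the factors \<open>a - c\<close> is zero modulo \<open>I\<close>, they cannot all be invertible modulo
\<open>I\<close>. Formally, one root is split off at a time.\<close>

lemma ideal_extend_by_linear_factor:
  assumes I: "function_ideal I" "(\<lambda>_. 1) \<notin> I" and a: "a \<in> reg V"
    and q: "q \<noteq> 0" "(\<lambda>x. poly q (a x)) \<in> I"
  shows "\<exists>c J. function_ideal J \<and> I \<subseteq> J \<and> (\<lambda>_. 1) \<notin> J \<and> (\<lambda>x. a x - c) \<in> J"
  using q
proof (induction "degree q" arbitrary: q)
  case 0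
  then obtain u where u: "q = [:u:]" "u \<noteq> 0"
    using degree_0_id[of q] by (metis pCons_0_0)
  then have "(\<lambda>x. inverse u * u) \<in> I"
    using ideal_mult[OF I(1) const[of "inverse u"] "0.prems"(2)] by simp
  then show ?case using I(2) u by simp
next
  case (Suc d)
  then obtain c where "poly q c = 0"
    using alg_closed_imp_poly_has_root[of q] by auto
  then obtain q' where q': "q = [:-c, 1:] * q'"
    by (auto simp: poly_eq_0_iff_dvd)
  let ?J = "{f. \<exists>i\<in>I. \<exists>r\<in>reg V. \<forall>x\<in>carrier V. f x = i x + (a x - c) * r x}"
  have ac: "(\<lambda>x. a x - c) \<in> reg V" using a by (intro diff const)
  have J: "function_ideal ?J"
    unfolding function_ideal_def
  proof (intro conjI ballI allI impI subsetI)
    fix f assume "f \<in> ?J"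
    then obtain i r where *: "i \<in> I" "r \<in> reg V" "\<forall>x\<in>carrier V. f x = i x + (a x - c) * r x" by auto
    show "f \<in> reg V"
      by (rule reg_cong[OF add[OF ideal_reg[OF I(1) *(1)] mult[OF ac *(2)]]]) (use *(3) in auto)
  next
    show "(\<lambda>_. 0) \<in> ?J"
      by (rule CollectI, rule bexI[OF _ ideal_zero[OF I(1)]], rule bexI[OF _ const[of 0]]) simp
  next
    fix f g assume "f \<in> ?J" "g \<in> ?J"
    then obtain i r j s where *: "i \<in> I" "r \<in> reg V" "\<forall>x\<in>carrier V. f x = i x + (a x - c) * r x"
      "j \<in> I" "s \<in> reg V" "\<forall>x\<in>carrier V. g x = j x + (a x - c) * s x" by auto
    show "(\<lambda>x. f x + g x) \<in> ?J"
      by (rule CollectI, rule bexI[of _ "\<lambda>x. i x + j x"], rule bexI[of _ "\<lambda>x. r x + s x"])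
         (use * in \<open>auto intro: add ideal_add[OF I(1)] simp: algebra_simps\<close>)
  next
    fix b f assume b: "b \<in> reg V" and "f \<in> ?J"
    then obtain i r where *: "i \<in> I" "r \<in> reg V" "\<forall>x\<in>carrier V. f x = i x + (a x - c) * r x" by auto
    show "(\<lambda>x. b x * f x) \<in> ?J"
      by (rule CollectI, rule bexI[of _ "\<lambda>x. b x * i x"], rule bexI[of _ "\<lambda>x. b x * r x"])
         (use * b in \<open>auto intro: mult ideal_mult[OF I(1)] simp: distrib_left mult.left_commute\<close>)
  qed auto
  have IJ: "I \<subseteq> ?J"
    by (intro subsetI CollectI, rule bexI[rotated], assumption,
        rule bexI[OF _ const[of 0]]) simp
  have acJ: "(\<lambda>x. a x - c) \<in> ?J"
    by (rule CollectI, rule bexI[OF _ ideal_zero[OF I(1)]], rule bexI[OF _ const[of 1]]) simp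
  show ?case
  proof (cases "(\<lambda>_. 1) \<in> ?J")
    case False
    then show ?thesis using J IJ acJ by blast
  next
    case True
    then obtain i r where i: "i \<in> I" and r: "r \<in> reg V"
      and eq: "\<forall>x\<in>carrier V. 1 = i x + (a x - c) * r x" by auto
    \<comment> \<open>If \<open>a - c\<close> is invertible modulo \<open>I\<close>, then the cofactor \<open>q'\<close> already annihilates \<open>a\<close>.\<close>
    have "(\<lambda>x. poly q' (a x) * i x + r x * poly q (a x)) \<in> I"
      by (intro ideal_add[OF I(1)] ideal_mult[OF I(1)] poly a i r Suc.prems(2))
    then have "(\<lambda>x. poly q' (a x)) \<in> I"
    proof (rule ideal_cong[OF I(1)])
      fix x assume "x \<in> carrier V"
      then have "poly q' (a x) = poly q' (a x) * (i x + (a x - c) * r x)" using eq by simp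
      then show "poly q' (a x) = poly q' (a x) * i x + r x * poly q (a x)"
        by (simp add: q' algebra_simps)
    qed
    moreover have "q' \<noteq> 0" "d = degree q'"
      using Suc.hyps(2) Suc.prems(1) by (auto simp: q' degree_mult_eq simp del: mult_pCons_left)
    ultimately show ?thesis using Suc.hyps(1) by blast
  qed
qed

lemma ideal_extend_by_linear_factors:
  fixes a :: "nat \<Rightarrow> 'a \<Rightarrow> complex"
  assumes I: "function_ideal I" "(\<lambda>_. 1) \<notin> I"
    and a: "\<And>i. i < n \<Longrightarrow> a i \<in> reg V"
    and q: "\<And>i. i < n \<Longrightarrow> \<exists>q. q \<noteq> 0 \<and> (\<lambda>x. poly q (a i x)) \<in> I"
  shows "\<exists>c J. function_ideal J \<and> I \<subseteq> J \<and> (\<lambda>_. 1) \<notin> J \<and> (\<forall>i<n. (\<lambda>x. a i x - c i) \<in> J)"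
  using a q
proof (induction n)
  case 0
  then show ?case using I by auto
next
  case (Suc n)
  then obtain c J where J: "function_ideal J" "I \<subseteq> J" "(\<lambda>_. 1) \<notin> J"
    and c: "\<forall>i<n. (\<lambda>x. a i x - c i) \<in> J" by auto
  obtain q where q: "q \<noteq> 0" "(\<lambda>x. poly q (a n x)) \<in> J" using Suc.prems(2) J(2) by blast
  have "a n \<in> reg V" using Suc.prems(1) by simp
  then obtain d J' where J': "function_ideal J'" "J \<subseteq> J'" "(\<lambda>_. 1) \<notin> J'" "(\<lambda>x. a n x - d) \<in> J'"
    using ideal_extend_by_linear_factor[OF J(1,3) _ q] by auto
  have "(\<lambda>x. a i x - (c(n := d)) i) \<in> J'" if "i < Suc n" for i
    using that c J' by (cases "i = n") auto
  then show ?case using J' J(2) by (intro exI[of _ "c(n := d)"] exI[of _ J']) auto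
qed

end

text \<open>The case of Hilbert's Nullstellensatz in which every function is algebraic over the constants
modulo the ideal. The coordinates of an embedding can be given constant values one after the other
while the ideal stays proper. The point \<open>c\<close> with these coordinates is the zero: modulo the enlarged
ideal, every polynomial \<open>p\<close> is congruent to \<open>p(c)\<close>, so a polynomial in the ideal that does not
vanish at \<open>c\<close> would make the ideal improper.\<close>

lemma integral_ideal_has_zero:
  assumes V: "affine_alg_set V" and I: "function_algebra.function_ideal V I" "(\<lambda>_. 1) \<notin> I"
    and integral: "\<And>a. a \<in> reg V \<Longrightarrow> \<exists>q. q \<noteq> 0 \<and> (\<lambda>x. poly q (a x)) \<in> I"
  shows "\<exists>x\<in>carrier V. \<forall>f\<in>I. f x = 0"
proof -
  interpret function_algebra V by (rule affine_function_algebra[OF V])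
  obtain n P e where P: "P \<subseteq> poly_funs n"
    and bij: "bij_betw e (carrier V) {x \<in> affine_space n. \<forall>p\<in>P. p x = 0}"
    and reg: "reg V = {f. \<exists>p\<in>poly_funs n. \<forall>x\<in>carrier V. f x = p (e x)}"
    using V by (rule affine_alg_setE)
  have e: "e x \<in> affine_space n" "\<And>p. p \<in> P \<Longrightarrow> p (e x) = 0" if "x \<in> carrier V" for x
    using bij_betwE[OF bij] that by auto
  have coord: "(\<lambda>x. e x i) \<in> reg V" if "i < n" for i
    unfolding reg by (intro CollectI bexI[OF _ coordinate_in_poly_funs[OF that]]) simp
  obtain c0 J where J: "function_ideal J" "I \<subseteq> J" "(\<lambda>_. 1) \<notin> J"
    and c0: "\<forall>i<n. (\<lambda>x. e x i - c0 i) \<in> J"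
    using ideal_extend_by_linear_factors[OF I, of n "\<lambda>i x. e x i"] coord integral by auto
  define c where "c = restrict c0 {..<n}"
  have c: "c \<in> affine_space n" by (simp add: c_def affine_space_def)
  \<comment> \<open>A polynomial in the coordinates is congruent to its value at \<open>c\<close> modulo \<open>J\<close>.\<close>
  have taylor: "(\<lambda>x. p (e x) - p c) \<in> J" if "p \<in> poly_funs n" for p
    using that unfolding poly_funs_def
  proof induction
    case (gen f)
    then show ?case using c0 by (auto simp: c_def)
  next
    case (const d)
    then show ?case using ideal_zero[OF J(1)] by simp
  next
    case (add f g)
    then show ?case using ideal_add[OF J(1) add.IH] by (simp add: algebra_simps)
  next
    case (mult f g)
    have "(\<lambda>x. g (e x)) \<in> reg V"
      using mult.hyps unfolding reg poly_funs_def by blast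
    then have "(\<lambda>x. g (e x) * (f (e x) - f c) + f c * (g (e x) - g c)) \<in> J"
      by (intro ideal_add[OF J(1)] ideal_mult[OF J(1)] const mult.IH)
    then show ?case by (simp add: algebra_simps)
  next
    case (cong f g)
    show ?case by (rule ideal_cong[OF J(1) cong.IH]) (use cong.hyps c e in auto)
  qed
  have zero: "p c = 0" if "p \<in> poly_funs n" "(\<lambda>x. p (e x)) \<in> J" for p
  proof (rule ccontr)
    assume "p c \<noteq> 0"
    have "(\<lambda>x. inverse (p c) * (p (e x) - (p (e x) - p c))) \<in> J"
      by (intro ideal_mult[OF J(1)] ideal_diff[OF J(1)] const that taylor)
    then show False using J(3) \<open>p c \<noteq> 0\<close> by simp
  qed
  have "p c = 0" if "p \<in> P" for p
    using zero[of p] P that ideal_cong[OF J(1) ideal_zero[OF J(1)], of "\<lambda>x. p (e x)"] e by auto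
  then obtain x where x: "x \<in> carrier V" "e x = c"
    using bij c unfolding bij_betw_def by (smt (verit) imageE mem_Collect_eq)
  have "f x = 0" if f: "f \<in> I" for f
  proof -
    obtain p where p: "p \<in> poly_funs n" "\<forall>x\<in>carrier V. f x = p (e x)"
      using ideal_reg[OF I(1) f] unfolding reg by blast
    have "(\<lambda>x. p (e x)) \<in> J"
      by (rule ideal_cong[OF J(1), of f]) (use p f J(2) in auto)
    then show ?thesis using zero p x by auto
  qed
  then show ?thesis using x by blast
qed


section \<open>Quotients of affine algebraic sets by finite groups\<close>

locale finite_group_action = group K for K :: "('k, 'm) monoid_scheme" (structure) +
  fixes X :: "'x alg_set" and act :: "'k \<Rightarrow> 'x \<Rightarrow> 'x"
  assumes finite_group: "finite (carrier K)"
    and affine: "affine_alg_set X"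
    and act_morphism: "k \<in> carrier K \<Longrightarrow> morphism X X (act k)"
    and act_one: "x \<in> carrier X \<Longrightarrow> act \<one> x = x"
    and act_mult: "k \<in> carrier K \<Longrightarrow> l \<in> carrier K \<Longrightarrow> x \<in> carrier X
      \<Longrightarrow> act (k \<otimes> l) x = act k (act l x)"
begin

sublocale X: function_algebra X
  by (rule affine_function_algebra[OF affine])

lemma act_closed: "k \<in> carrier K \<Longrightarrow> x \<in> carrier X \<Longrightarrow> act k x \<in> carrier X"
  using act_morphism by (rule morphism_closed)

lemma act_regular: "k \<in> carrier K \<Longrightarrow> f \<in> reg X \<Longrightarrow> (\<lambda>x. f (act k x)) \<in> reg X"
  using act_morphism by (rule morphism_regular)

lemma right_mult_bij: "l \<in> carrier K \<Longrightarrow> bij_betw (\<lambda>k. k \<otimes> l) (carrier K) (carrier K)"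
  by (rule bij_betw_byWitness[where f' = "\<lambda>k. k \<otimes> inv l"]) (auto simp: m_assoc)

lemma sum_act_invariant:
  assumes "l \<in> carrier K" "x \<in> carrier X"
  shows "(\<Sum>k\<in>carrier K. f (act k (act l x))) = (\<Sum>k\<in>carrier K. f (act k x))"
  using sum.reindex_bij_betw[OF right_mult_bij[OF assms(1)], of "\<lambda>k. f (act k x)"] assms
  by (simp add: act_mult)

lemma prod_act_invariant:
  assumes "l \<in> carrier K" "x \<in> carrier X"
  shows "(\<Prod>k\<in>carrier K. f (act k (act l x))) = (\<Prod>k\<in>carrier K. f (act k x))"
  using prod.reindex_bij_betw[OF right_mult_bij[OF assms(1)], of "\<lambda>k. f (act k x)"] assms
  by (simp add: act_mult)

text \<open>If \<open>u\<close> vanishes at \<open>x\<close> and is \<open>1\<close> on the orbit of \<open>y\<close>, then its norm, the product of its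
translates, is an invariant that distinguishes \<open>x\<close> from \<open>y\<close>. Such a \<open>u\<close> exists by interpolation at
finitely many points.\<close>

lemma invariants_separate_orbits:
  assumes x: "x \<in> carrier X" and y: "y \<in> carrier X" and not_orbit: "\<forall>k\<in>carrier K. act k y \<noteq> x"
  obtains f where "f \<in> reg X" "invariant_on (carrier K) act (carrier X) f" "f x \<noteq> f y"
proof -
  have "\<exists>g\<in>reg X. g x = 1 \<and> g (act k y) = 0" if k: "k \<in> carrier K" for k
  proof -
    obtain g where g: "g \<in> reg X" "g (act k y) \<noteq> g x"
      using affine_separates_points[OF affine act_closed[OF k y] x] not_orbit k by blast
    then show ?thesis
      by (intro bexI[of _ "\<lambda>z. inverse (g x - g (act k y)) * (g z - g (act k y))"]
          X.scale X.diff X.const) auto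
  qed
  then obtain g where g: "\<And>k. k \<in> carrier K \<Longrightarrow> g k \<in> reg X"
    "\<And>k. k \<in> carrier K \<Longrightarrow> g k x = 1" "\<And>k. k \<in> carrier K \<Longrightarrow> g k (act k y) = 0"
    by metis
  define u where "u z = 1 - (\<Prod>k\<in>carrier K. g k z)" for z
  have u: "u \<in> reg X" unfolding u_def by (intro X.diff X.const X.prod g)
  have ux: "u x = 0" using g by (simp add: u_def)
  have uy: "u (act k y) = 1" if "k \<in> carrier K" for k
  proof -
    have "(\<Prod>l\<in>carrier K. g l (act k y)) = 0"
      using g(3) that finite_group by (intro prod_zero) blast+
    then show ?thesis by (simp add: u_def)
  qed
  show ?thesis
  proof
    let ?f = "\<lambda>z. \<Prod>k\<in>carrier K. u (act k z)"
    show "?f \<in> reg X" by (intro X.prod act_regular u)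
    show "invariant_on (carrier K) act (carrier X) ?f"
      unfolding invariant_on_def using prod_act_invariant by blast
    have "?f x = 0"
      using ux act_one[OF x] finite_group by (intro prod_zero bexI[OF _ one_closed]) auto
    moreover have "?f y = 1" using uy by simp
    ultimately show "?f x \<noteq> ?f y" by simp
  qed
qed

text \<open>Integrality of the regular functions over the invariants comes from the polynomial with roots
\<open>a (act k x)\<close>. Here its coefficients are shown to be regular in \<open>x\<close>; the partial product over \<open>L\<close>
is needed for the induction.\<close>

lemma char_poly_coeff_regular:
  assumes "a \<in> reg X" "L \<subseteq> carrier K"
  shows "(\<lambda>x. coeff (\<Prod>k\<in>L. [:- a (act k x), 1:]) m) \<in> reg X"
proof -
  have "finite L" using assms(2) finite_group finite_subset by blast
  then show ?thesis using assms(2)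
  proof (induction L arbitrary: m)
    case empty
    then show ?case using X.const by simp
  next
    case (insert k L)
    have *: "(\<lambda>x. coeff (\<Prod>k\<in>L. [:- a (act k x), 1:]) m) \<in> reg X" for m
      using insert by auto
    have "(\<lambda>x. case m of 0 \<Rightarrow> 0 | Suc m' \<Rightarrow> coeff (\<Prod>k\<in>L. [:- a (act k x), 1:]) m') \<in> reg X"
      using * X.const by (cases m) auto
    moreover have "(\<lambda>x. a (act k x)) \<in> reg X"
      using insert assms(1) act_regular by auto
    ultimately have "(\<lambda>x. (case m of 0 \<Rightarrow> 0 | Suc m' \<Rightarrow> coeff (\<Prod>k\<in>L. [:- a (act k x), 1:]) m') -
        a (act k x) * coeff (\<Prod>k\<in>L. [:- a (act k x), 1:]) m) \<in> reg X"
      by (intro X.diff X.mult *)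
    then show ?case
      using insert.hyps by (simp add: coeff_pCons cong: nat.case_cong)
  qed
qed

end

text \<open>The algebraic description of a quotient by a finite group: pullback along \<open>h\<close> identifies the
regular functions on \<open>Y\<close> with the invariants on \<open>X\<close>. The aim is that \<open>h\<close> is then also the quotient
on points, that is, surjective with the orbits as its fibres.\<close>

locale finite_quotient_map = finite_group_action K X act
  for K :: "('k, 'm) monoid_scheme" (structure) and X :: "'x alg_set"
    and act :: "'k \<Rightarrow> 'x \<Rightarrow> 'x" +
  fixes Y :: "'y alg_set" and h :: "'x \<Rightarrow> 'y"
  assumes Y_affine: "affine_alg_set Y"
    and h_morphism: "morphism X Y h"
    and h_invariant: "k \<in> carrier K \<Longrightarrow> x \<in> carrier X \<Longrightarrow> h (act k x) = h x"
    and invariants_descend: "f \<in> reg X \<Longrightarrow> invariant_on (carrier K) act (carrier X) f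
      \<Longrightarrow> \<exists>g\<in>reg Y. \<forall>x\<in>carrier X. g (h x) = f x"
    and h_dominant: "g \<in> reg Y \<Longrightarrow> \<forall>x\<in>carrier X. g (h x) = 0 \<Longrightarrow> y \<in> carrier Y \<Longrightarrow> g y = 0"
begin

sublocale Y: function_algebra Y
  by (rule affine_function_algebra[OF Y_affine])

lemma fibres_are_orbits:
  assumes "x \<in> carrier X" "y \<in> carrier X" "h x = h y"
  shows "\<exists>k\<in>carrier K. act k y = x"
proof (rule ccontr)
  assume "\<not> ?thesis"
  then obtain f where "f \<in> reg X" "invariant_on (carrier K) act (carrier X) f" "f x \<noteq> f y"
    using assms invariants_separate_orbits[of x y] by blast
  then show False using invariants_descend assms by metis
qed

text \<open>The functional that sums \<open>f\<close> over the fibre above \<open>y\<close> with multiplicities, defined without knowing that the fibre is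
nonempty: the sum of the translates of \<open>f\<close> is invariant, so it is the pullback of a function on \<open>Y\<close>,
which is evaluated at \<open>y\<close>. That function is determined on \<open>Y\<close> only, hence the choice.\<close>

definition fibre_trace :: "'y \<Rightarrow> ('x \<Rightarrow> complex) \<Rightarrow> complex" where
  "fibre_trace y f =
     (SOME g. g \<in> reg Y \<and> (\<forall>x\<in>carrier X. g (h x) = (\<Sum>k\<in>carrier K. f (act k x)))) y"

lemma fibre_trace_eq:
  assumes y: "y \<in> carrier Y" and g: "g \<in> reg Y"
    and eq: "\<And>x. x \<in> carrier X \<Longrightarrow> g (h x) = (\<Sum>k\<in>carrier K. f (act k x))"
  shows "fibre_trace y f = g y"
proof -
  define g' where "g' = (SOME g. g \<in> reg Y \<and> (\<forall>x\<in>carrier X. g (h x) = (\<Sum>k\<in>carrier K. f (act k x))))"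
  have "g' \<in> reg Y \<and> (\<forall>x\<in>carrier X. g' (h x) = (\<Sum>k\<in>carrier K. f (act k x)))"
    unfolding g'_def by (rule someI[of _ g]) (use g eq in auto)
  then have "g' y - g y = 0"
    by (intro h_dominant[of "\<lambda>y. g' y - g y"]) (use g eq y in \<open>auto intro: Y.diff\<close>)
  then show ?thesis by (simp add: fibre_trace_def g'_def)
qed

lemma trace_descends:
  assumes "f \<in> reg X"
  obtains g where "g \<in> reg Y" "\<And>x. x \<in> carrier X \<Longrightarrow> g (h x) = (\<Sum>k\<in>carrier K. f (act k x))"
proof -
  have "(\<lambda>x. \<Sum>k\<in>carrier K. f (act k x)) \<in> reg X"
    by (intro X.sum act_regular assms)
  then show ?thesis
    using invariants_descend[of "\<lambda>x. \<Sum>k\<in>carrier K. f (act k x)"] sum_act_invariant[of _ _ f] that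
    unfolding invariant_on_def by blast
qed

lemma fibre_trace_add:
  assumes y: "y \<in> carrier Y" and "f1 \<in> reg X" "f2 \<in> reg X"
  shows "fibre_trace y (\<lambda>x. f1 x + f2 x) = fibre_trace y f1 + fibre_trace y f2"
proof -
  obtain g1 where g1: "g1 \<in> reg Y" "\<And>x. x \<in> carrier X \<Longrightarrow> g1 (h x) = (\<Sum>k\<in>carrier K. f1 (act k x))"
    using assms(2) by (rule trace_descends) blast
  obtain g2 where g2: "g2 \<in> reg Y" "\<And>x. x \<in> carrier X \<Longrightarrow> g2 (h x) = (\<Sum>k\<in>carrier K. f2 (act k x))"
    using assms(3) by (rule trace_descends) blast
  have "fibre_trace y (\<lambda>x. f1 x + f2 x) = g1 y + g2 y"
    by (rule fibre_trace_eq[OF y Y.add[OF g1(1) g2(1)]]) (simp add: g1 g2 sum.distrib)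
  then show ?thesis using fibre_trace_eq[OF y g1] fibre_trace_eq[OF y g2] by simp
qed

lemma fibre_trace_pullback:
  assumes y: "y \<in> carrier Y" and f: "f \<in> reg X" and b: "b \<in> reg Y"
  shows "fibre_trace y (\<lambda>x. b (h x) * f x) = b y * fibre_trace y f"
proof -
  obtain g where g: "g \<in> reg Y" "\<And>x. x \<in> carrier X \<Longrightarrow> g (h x) = (\<Sum>k\<in>carrier K. f (act k x))"
    using f by (rule trace_descends) blast
  have "fibre_trace y (\<lambda>x. b (h x) * f x) = b y * g y"
    by (rule fibre_trace_eq[OF y Y.mult[OF b g(1)]])
       (simp add: g(2) h_invariant sum_distrib_left)
  then show ?thesis using fibre_trace_eq[OF y g] by simp
qed

lemma fibre_trace_cong:
  assumes "\<And>x. x \<in> carrier X \<Longrightarrow> f x = f' x"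
  shows "fibre_trace y f = fibre_trace y f'"
proof -
  have "(\<Sum>k\<in>carrier K. f (act k x)) = (\<Sum>k\<in>carrier K. f' (act k x))" if "x \<in> carrier X" for x
    using that assms act_closed by (intro sum.cong) auto
  then show ?thesis unfolding fibre_trace_def by (simp cong: conj_cong ball_cong)
qed

lemma fibre_trace_one:
  assumes "y \<in> carrier Y"
  shows "fibre_trace y (\<lambda>_. 1) \<noteq> 0"
  using fibre_trace_eq[OF assms Y.const[of "of_nat (card (carrier K))"], of "\<lambda>_. 1"]
    finite_group one_closed by auto

text \<open>The kernel of the bilinear form given by the trace, as a substitute for the ideal generated by
the pullbacks of the functions that vanish at \<open>y\<close>. It contains this ideal, and it is proper because
the trace of \<open>1\<close> is the order of the group.\<close>

definition fibre_ideal :: "'y \<Rightarrow> ('x \<Rightarrow> complex) set" where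
  "fibre_ideal y = {f \<in> reg X. \<forall>a\<in>reg X. fibre_trace y (\<lambda>x. a x * f x) = 0}"

lemma fibre_ideal_function_ideal:
  assumes y: "y \<in> carrier Y"
  shows "X.function_ideal (fibre_ideal y)"
  unfolding X.function_ideal_def
proof (intro conjI ballI allI impI)
  show "fibre_ideal y \<subseteq> reg X" by (auto simp: fibre_ideal_def)
  have "fibre_trace y (\<lambda>_. 0) = 0"
    using fibre_trace_eq[OF y Y.const[of 0], of "\<lambda>_. 0"] by simp
  then show "(\<lambda>_. 0) \<in> fibre_ideal y" by (simp add: fibre_ideal_def X.const)
  show "(\<lambda>x. f x + g x) \<in> fibre_ideal y" if "f \<in> fibre_ideal y" "g \<in> fibre_ideal y" for f g
    using that by (simp add: fibre_ideal_def X.add X.mult fibre_trace_add[OF y] distrib_left)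
  show "(\<lambda>x. a x * f x) \<in> fibre_ideal y" if a: "a \<in> reg X" and f: "f \<in> fibre_ideal y" for a f
  proof -
    have "fibre_trace y (\<lambda>x. b x * (a x * f x)) = 0" if "b \<in> reg X" for b
      using f X.mult[OF that a] by (simp add: fibre_ideal_def mult.assoc[symmetric])
    then show ?thesis using f a by (simp add: fibre_ideal_def X.mult)
  qed
  show "g \<in> fibre_ideal y" if f: "f \<in> fibre_ideal y" and eq: "\<forall>x\<in>carrier X. g x = f x" for f g
  proof -
    have "g \<in> reg X"
      by (rule X.reg_cong[of f g]) (use f eq in \<open>simp_all add: fibre_ideal_def\<close>)
    moreover have "fibre_trace y (\<lambda>x. a x * g x) = fibre_trace y (\<lambda>x. a x * f x)" for a
      by (rule fibre_trace_cong) (simp add: eq)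
    ultimately show ?thesis using f by (simp add: fibre_ideal_def)
  qed
qed

lemma pullback_in_fibre_ideal:
  assumes y: "y \<in> carrier Y" and f: "f \<in> reg X" and b: "b \<in> reg Y" and "b y = 0"
  shows "(\<lambda>x. b (h x) * f x) \<in> fibre_ideal y"
proof -
  have "fibre_trace y (\<lambda>x. a x * (b (h x) * f x)) = 0" if "a \<in> reg X" for a
    using fibre_trace_pullback[OF y X.mult[OF that f] b] \<open>b y = 0\<close>
    by (simp add: mult.left_commute)
  then show ?thesis
    using f b by (simp add: fibre_ideal_def X.mult morphism_regular[OF h_morphism])
qed

text \<open>The coefficients of the orbit polynomial of \<open>a\<close> are pullbacks of functions \<open>b m\<close> on \<open>Y\<close>, hence
congruent to the constants \<open>b m y\<close> modulo the fibre ideal. Replacing them by these constants gives a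
polynomial \<open>q\<close> that annihilates \<open>a\<close> modulo the fibre ideal.\<close>

lemma integral_modulo_fibre_ideal:
  assumes y: "y \<in> carrier Y" and a: "a \<in> reg X"
  shows "\<exists>q. q \<noteq> 0 \<and> (\<lambda>x. poly q (a x)) \<in> fibre_ideal y"
proof -
  let ?d = "card (carrier K)"
  define P where "P x = (\<Prod>k\<in>carrier K. [:- a (act k x), 1:])" for x
  have degP: "degree (P x) = ?d" for x
    unfolding P_def by (subst degree_prod_sum_eq) auto
  have "lead_coeff (P x) = 1" for x
    unfolding P_def by (subst lead_coeff_prod) simp
  then have top: "coeff (P x) ?d = 1" for x by (simp add: degP)
  have "\<exists>b\<in>reg Y. \<forall>x\<in>carrier X. b (h x) = coeff (P x) m" for m
  proof (rule invariants_descend)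
    show "(\<lambda>x. coeff (P x) m) \<in> reg X"
      unfolding P_def by (rule char_poly_coeff_regular[OF a order_refl])
    show "invariant_on (carrier K) act (carrier X) (\<lambda>x. coeff (P x) m)"
      unfolding invariant_on_def P_def
      using prod_act_invariant[where f = "\<lambda>z. [:- a z, 1:]"] by simp
  qed
  then obtain b where b: "\<And>m. b m \<in> reg Y"
    "\<And>m x. x \<in> carrier X \<Longrightarrow> b m (h x) = coeff (P x) m" by metis
  define q where "q = (\<Sum>m\<le>?d. monom (b m y) m)"
  have coeff_q: "coeff q ?d = b ?d y" by (simp add: q_def coeff_sum)
  have "b ?d y - 1 = 0"
    by (rule h_dominant[of "\<lambda>y. b ?d y - 1"]) (use b y top in \<open>auto intro: Y.diff Y.const\<close>)
  then have q0: "q \<noteq> 0" using coeff_q by auto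
  have ideal: "X.function_ideal (fibre_ideal y)" by (rule fibre_ideal_function_ideal[OF y])
  \<comment> \<open>The factor of \<open>P x\<close> that belongs to \<open>\<one>\<close> vanishes at \<open>a x\<close>.\<close>
  have root: "(\<Sum>m\<le>?d. coeff (P x) m * a x ^ m) = 0" if x: "x \<in> carrier X" for x
  proof -
    have "poly (P x) (a x) = 0"
      unfolding P_def poly_prod using finite_group act_one[OF x]
      by (intro prod_zero bexI[OF _ one_closed]) auto
    then show ?thesis by (simp add: poly_altdef degP)
  qed
  have sum_in: "(\<lambda>x. \<Sum>m\<in>M. (b m (h x) - b m y) * a x ^ m) \<in> fibre_ideal y" if "finite M" for M
    using that
  proof induction
    case empty
    then show ?case using X.ideal_zero[OF ideal] by simp
  next
    case (insert m M)
    have "(\<lambda>x. (b m (h x) - b m y) * a x ^ m) \<in> fibre_ideal y"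
      by (rule pullback_in_fibre_ideal[OF y X.power[OF a] Y.diff[OF b(1) Y.const]]) simp
    then show ?case
      using insert X.ideal_add[OF ideal] by simp
  qed
  have "(\<lambda>x. -1 * (\<Sum>m\<le>?d. (b m (h x) - b m y) * a x ^ m)) \<in> fibre_ideal y"
    by (intro X.ideal_mult[OF ideal] X.const sum_in) simp
  then have "(\<lambda>x. poly q (a x)) \<in> fibre_ideal y"
  proof (rule X.ideal_cong[OF ideal])
    fix x assume x: "x \<in> carrier X"
    have "(\<Sum>m\<le>?d. (b m (h x) - b m y) * a x ^ m)
        = (\<Sum>m\<le>?d. coeff (P x) m * a x ^ m) - (\<Sum>m\<le>?d. b m y * a x ^ m)"
      by (simp add: b(2)[OF x] left_diff_distrib sum_subtractf)
    then show "poly q (a x) = -1 * (\<Sum>m\<le>?d. (b m (h x) - b m y) * a x ^ m)"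
      by (simp add: root[OF x] q_def poly_sum poly_monom)
  qed
  then show ?thesis using q0 by blast
qed

text \<open>A common zero \<open>x\<close> of the fibre ideal lies above \<open>y\<close>: for each regular \<open>g\<close> on \<open>Y\<close> the ideal contains
the pullback of \<open>g - g y\<close>.\<close>

lemma surjective:
  assumes y: "y \<in> carrier Y"
  shows "\<exists>x\<in>carrier X. h x = y"
proof -
  have "(\<lambda>_. 1) \<notin> fibre_ideal y"
    using fibre_trace_one[OF y] X.const[of 1] by (auto simp: fibre_ideal_def)
  then obtain x where x: "x \<in> carrier X" and zero: "\<forall>f\<in>fibre_ideal y. f x = 0"
    using integral_ideal_has_zero[OF affine fibre_ideal_function_ideal[OF y]]
      integral_modulo_fibre_ideal[OF y] by blast
  have "h x = y"
  proof (rule affine_separates_points[OF Y_affine morphism_closed[OF h_morphism x] y])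
    fix g assume "g \<in> reg Y"
    then have "(\<lambda>x. (g (h x) - g y) * 1) \<in> fibre_ideal y"
      using pullback_in_fibre_ideal[OF y X.const[of 1] Y.diff[OF _ Y.const[of "g y"]]] by simp
    then show "g (h x) = g y" using zero by force
  qed
  then show ?thesis using x by blast
qed

text \<open>On points, \<open>h\<close> induces a bijection from orbits to \<open>Y\<close>. Its inverse \<open>\<theta>\<close> is a morphism because a
regular function on the orbit space is by definition an invariant on \<open>X\<close>, and invariants descend to
\<open>Y\<close>.\<close>

lemma orbit_space_isomorphism:
  fixes orbit :: "'x \<Rightarrow> 'x set"
  assumes orbit: "\<And>x. x \<in> carrier X \<Longrightarrow> orbit x = (\<lambda>k. act k x) ` carrier K"
  obtains \<psi> where "\<psi> \<in> extensional (carrier (quotient_alg_set X orbit))"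
    "\<And>x. x \<in> carrier X \<Longrightarrow> \<psi> (orbit x) = h x"
    "isomorphism (quotient_alg_set X orbit) Y \<psi>"
proof -
  let ?Q = "quotient_alg_set X orbit"
  define \<psi> where "\<psi> = (\<lambda>c\<in>orbit ` carrier X. h (SOME x. x \<in> carrier X \<and> orbit x = c))"
  define \<theta> where "\<theta> y = orbit (SOME x. x \<in> carrier X \<and> h x = y)" for y
  have h_eq: "h x = h y" if xy: "x \<in> carrier X" "y \<in> carrier X" and orb: "orbit x = orbit y" for x y
  proof -
    have "x \<in> orbit x"
      unfolding orbit[OF xy(1)] by (rule image_eqI[OF _ one_closed]) (simp add: act_one xy)
    then obtain k where "k \<in> carrier K" "x = act k y"
      using orb orbit[OF xy(2)] by auto
    then show ?thesis using h_invariant xy by simp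
  qed
  have orbit_eq: "orbit x = orbit y" if xy: "x \<in> carrier X" "y \<in> carrier X" "h x = h y" for x y
  proof -
    obtain k where k: "k \<in> carrier K" "act k y = x" using fibres_are_orbits[OF xy] by blast
    have "orbit x = (\<lambda>l. act (l \<otimes> k) y) ` carrier K"
      unfolding orbit[OF xy(1)] using k xy by (intro image_cong) (auto simp: act_mult)
    also have "\<dots> = (\<lambda>l. act l y) ` (\<lambda>l. l \<otimes> k) ` carrier K"
      by (simp add: image_image)
    also have "\<dots> = orbit y"
      using right_mult_bij[OF k(1)] orbit[OF xy(2)] by (simp add: bij_betw_def)
    finally show ?thesis .
  qed
  have psi: "\<psi> (orbit x) = h x" if x: "x \<in> carrier X" for x
  proof -
    have "\<exists>z. z \<in> carrier X \<and> orbit z = orbit x" using x by blast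
    then have "(SOME z. z \<in> carrier X \<and> orbit z = orbit x) \<in> carrier X \<and>
        orbit (SOME z. z \<in> carrier X \<and> orbit z = orbit x) = orbit x"
      by (rule someI_ex)
    then have "h (SOME z. z \<in> carrier X \<and> orbit z = orbit x) = h x"
      by (intro h_eq) (use x in auto)
    then show ?thesis using x by (simp add: \<psi>_def)
  qed
  have theta: "\<exists>x\<in>carrier X. h x = y \<and> \<theta> y = orbit x" if "y \<in> carrier Y" for y
  proof -
    have "\<exists>x. x \<in> carrier X \<and> h x = y" using surjective[OF that] by blast
    then have "(SOME x. x \<in> carrier X \<and> h x = y) \<in> carrier X \<and>
        h (SOME x. x \<in> carrier X \<and> h x = y) = y"
      by (rule someI_ex)
    then show ?thesis unfolding \<theta>_def by blast
  qed
  have theta_h: "\<theta> (h x) = orbit x" if x: "x \<in> carrier X" for x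
    using theta[OF morphism_closed[OF h_morphism x]] orbit_eq x by metis
  have psi_morphism: "morphism ?Q Y \<psi>"
  proof (rule morphismI)
    show "\<psi> c \<in> carrier Y" if "c \<in> carrier ?Q" for c
      using that psi morphism_closed[OF h_morphism] by (auto simp: quotient_alg_set_def)
    show "(\<lambda>c. g (\<psi> c)) \<in> reg ?Q" if "g \<in> reg Y" for g
      using X.reg_cong[OF morphism_regular[OF h_morphism that], of "\<lambda>x. g (\<psi> (orbit x))"] psi
      by (simp add: quotient_alg_set_def comp_def)
  qed
  have theta_morphism: "morphism Y ?Q \<theta>"
  proof (rule morphismI)
    show "\<theta> y \<in> carrier ?Q" if "y \<in> carrier Y" for y
      using theta[OF that] by (auto simp: quotient_alg_set_def)
    show "(\<lambda>y. f (\<theta> y)) \<in> reg Y" if "f \<in> reg ?Q" for f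
    proof -
      have "(\<lambda>x. f (orbit x)) \<in> reg X"
        using that by (simp add: quotient_alg_set_def comp_def)
      moreover have "invariant_on (carrier K) act (carrier X) (\<lambda>x. f (orbit x))"
        unfolding invariant_on_def using orbit_eq h_invariant act_closed by metis
      ultimately obtain g where g: "g \<in> reg Y" "\<forall>x\<in>carrier X. g (h x) = f (orbit x)"
        using invariants_descend by blast
      show ?thesis
        by (rule Y.reg_cong[OF g(1)]) (use theta g(2) in metis)
    qed
  qed
  show ?thesis
  proof
    show "\<psi> \<in> extensional (carrier ?Q)"
      by (simp add: \<psi>_def quotient_alg_set_def)
    show "\<psi> (orbit x) = h x" if "x \<in> carrier X" for x using that by (rule psi)
    have "\<forall>c\<in>carrier ?Q. \<theta> (\<psi> c) = c"
      using psi theta_h by (auto simp: quotient_alg_set_def)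
    moreover have "\<forall>y\<in>carrier Y. \<psi> (\<theta> y) = y"
      using theta psi by metis
    ultimately show "isomorphism ?Q Y \<psi>"
      unfolding isomorphism_def using psi_morphism theta_morphism by blast
  qed
qed

end


section \<open>Regular functions on powers\<close>

lemma power_function_algebra: "function_algebra (power_alg_set N V)"
  unfolding power_alg_set_def by (rule function_algebra_fun_alg)

lemma power_coordinate_regular:
  "f \<in> reg V \<Longrightarrow> i < N \<Longrightarrow> (\<lambda>x. f (x i)) \<in> reg (power_alg_set N V)"
  unfolding power_alg_set_def by (auto intro: fun_alg.gen)

lemma power_morphism:
  assumes "\<And>i. i < N \<Longrightarrow> morphism V W (\<phi> i)"
  shows "morphism (power_alg_set N V) (power_alg_set N W) (\<lambda>x. \<lambda>i\<in>{..<N}. \<phi> i (x i))"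
proof (rule morphismI)
  show closed: "(\<lambda>i\<in>{..<N}. \<phi> i (x i)) \<in> carrier (power_alg_set N W)"
    if "x \<in> carrier (power_alg_set N V)" for x
    using that morphism_closed[OF assms] by (auto simp: power_alg_set_def PiE_iff)
  show "(\<lambda>x. g (\<lambda>i\<in>{..<N}. \<phi> i (x i))) \<in> reg (power_alg_set N V)"
    if g: "g \<in> reg (power_alg_set N W)" for g
  proof -
    have g': "g \<in> fun_alg ({..<N} \<rightarrow>\<^sub>E carrier W) {\<lambda>x. f (x i) | f i. f \<in> reg W \<and> i < N}"
      using g by (simp add: power_alg_set_def)
    show ?thesis
    proof (rule function_algebra.fun_alg_compose[OF power_function_algebra g'])
      show "(\<lambda>i\<in>{..<N}. \<phi> i (x i)) \<in> {..<N} \<rightarrow>\<^sub>E carrier W"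
        if "x \<in> carrier (power_alg_set N V)" for x
        using closed[OF that] by (simp add: power_alg_set_def)
      show "(\<lambda>x. f (\<lambda>i\<in>{..<N}. \<phi> i (x i))) \<in> reg (power_alg_set N V)"
        if "f \<in> {\<lambda>x. f (x i) | f i. f \<in> reg W \<and> i < N}" for f
        using that power_coordinate_regular[OF morphism_regular[OF assms]] by auto
    qed
  qed
qed

text \<open>The span of the pure tensors, which is the coordinate ring of a power in the form that suits
coordinatewise averaging. The scalar \<open>c\<close> is listed separately because for \<open>N = 0\<close> it cannot be
absorbed into a factor.\<close>

inductive_set tensor_span :: "nat \<Rightarrow> 'a alg_set \<Rightarrow> ((nat \<Rightarrow> 'a) \<Rightarrow> complex) set"
  for N :: nat and V :: "'a alg_set" where
  pure: "(\<And>i. i < N \<Longrightarrow> f i \<in> reg V) \<Longrightarrow> (\<lambda>x. c * (\<Prod>i<N. f i (x i))) \<in> tensor_span N V"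
| add: "F \<in> tensor_span N V \<Longrightarrow> F' \<in> tensor_span N V \<Longrightarrow> (\<lambda>x. F x + F' x) \<in> tensor_span N V"
| cong: "F \<in> tensor_span N V \<Longrightarrow> (\<And>x. x \<in> {..<N} \<rightarrow>\<^sub>E carrier V \<Longrightarrow> F' x = F x)
    \<Longrightarrow> F' \<in> tensor_span N V"

lemma (in function_algebra) tensor_span_mult_pure:
  assumes f: "\<And>i. i < N \<Longrightarrow> f i \<in> reg V" and "F \<in> tensor_span N V"
  shows "(\<lambda>x. c * (\<Prod>i<N. f i (x i)) * F x) \<in> tensor_span N V"
  using assms(2)
proof induction
  case (pure g d)
  have "(\<lambda>x. (c * d) * (\<Prod>i<N. f i (x i) * g i (x i))) \<in> tensor_span N V"
    using tensor_span.pure[where f = "\<lambda>i y. f i y * g i y" and c = "c * d"] mult[OF f pure] by blast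
  then show ?case by (simp add: prod.distrib mult.assoc mult.left_commute)
next
  case (add F F')
  then show ?case using tensor_span.add[OF add.IH] by (simp add: distrib_left)
next
  case (cong F F')
  show ?case by (rule tensor_span.cong[OF cong.IH]) (simp add: cong.hyps)
qed

lemma (in function_algebra) tensor_span_mult:
  assumes "F \<in> tensor_span N V" "F' \<in> tensor_span N V"
  shows "(\<lambda>x. F x * F' x) \<in> tensor_span N V"
  using assms(1)
proof induction
  case (pure f c)
  then show ?case using tensor_span_mult_pure assms(2) by blast
next
  case (add F1 F2)
  then show ?case using tensor_span.add[OF add.IH] by (simp add: distrib_right)
next
  case (cong F1 F2)
  show ?case by (rule tensor_span.cong[OF cong.IH]) (simp add: cong.hyps)
qed

lemma (in function_algebra) power_regular_in_tensor_span:
  assumes "F \<in> reg (power_alg_set N V)"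
  shows "F \<in> tensor_span N V"
proof -
  have "F \<in> fun_alg ({..<N} \<rightarrow>\<^sub>E carrier V) {\<lambda>x. f (x i) | f i. f \<in> reg V \<and> i < N}"
    using assms by (simp add: power_alg_set_def)
  then show ?thesis
  proof induction
    case (gen F)
    then obtain f j where F: "F = (\<lambda>x. f (x j))" "f \<in> reg V" "j < N" by blast
    have "(\<lambda>x. 1 * (\<Prod>i<N. (if i = j then f else (\<lambda>_. 1)) (x i))) \<in> tensor_span N V"
      by (rule tensor_span.pure) (simp add: F const)
    moreover have "(\<Prod>i<N. (if i = j then f else (\<lambda>_. 1)) (x i)) = f (x j)" for x
    proof -
      have "(\<Prod>i<N. (if i = j then f else (\<lambda>_. 1)) (x i)) = (\<Prod>i<N. if i = j then f (x i) else 1)"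
        by (intro prod.cong) auto
      then show ?thesis using F(3) by simp
    qed
    ultimately show ?case by (simp add: F(1))
  next
    case (const c)
    show ?case
      using tensor_span.pure[of N "\<lambda>_ _. 1" V c] function_algebra.const[OF function_algebra_axioms, of 1] by simp
  next
    case (add f g)
    then show ?case by (intro tensor_span.add)
  next
    case (mult f g)
    then show ?case by (intro tensor_span_mult)
  next
    case (cong f g)
    then show ?case using tensor_span.cong by blast
  qed
qed


section \<open>Finite central quotients of affine algebraic groups\<close>

locale finite_central_subgroup =
  fixes G :: "'a alg_group" (structure) and H :: "'a set"
  assumes affine_group: "affine_alg_group G"
    and subgroup: "subgroup H G"
    and finite: "finite H"
    and central: "h \<in> H \<Longrightarrow> g \<in> carrier G \<Longrightarrow> h \<otimes> g = g \<otimes> h"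
begin

sublocale group G
  using affine_group by (simp add: affine_alg_group_def)

sublocale G: function_algebra "var G"
  using affine_group by (intro affine_function_algebra) (simp add: affine_alg_group_def)

abbreviation Q where "Q \<equiv> quotient_group G H"

lemma H_closed: "h \<in> H \<Longrightarrow> h \<in> carrier G"
  using subgroup.subset[OF subgroup] by blast

lemma normal_H: "H \<lhd> G"
  by (rule normalI[OF subgroup]) (auto simp: r_coset_def l_coset_def central)

lemma coset_closed: "x \<in> carrier G \<Longrightarrow> H #> x \<in> carrier Q"
  by (auto simp: quotient_group_def FactGroup_def RCOSETS_def)

lemma coset_cases:
  assumes "C \<in> carrier Q"
  obtains x where "x \<in> carrier G" "C = H #> x"
  using assms by (auto simp: quotient_group_def FactGroup_def RCOSETS_def)

lemma coset_mult: "x \<in> carrier G \<Longrightarrow> y \<in> carrier G \<Longrightarrow> (H #> x) \<otimes>\<^bsub>Q\<^esub> (H #> y) = H #> (x \<otimes> y)"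
  using normal.rcos_sum[OF normal_H] by (simp add: quotient_group_def FactGroup_def)

lemma coset_inv:
  assumes "x \<in> carrier G"
  shows "inv\<^bsub>Q\<^esub> (H #> x) = H #> inv x"
proof -
  have "inv\<^bsub>Q\<^esub> (H #> x) = inv\<^bsub>G Mod H\<^esub> (H #> x)"
    by (simp add: m_inv_def quotient_group_def)
  also have "\<dots> = set_inv (H #> x)"
    using coset_closed[OF assms] by (intro normal.inv_FactGroup[OF normal_H]) (simp add: quotient_group_def)
  also have "\<dots> = H #> inv x" by (rule normal.rcos_inv[OF normal_H assms])
  finally show ?thesis .
qed

lemma coset_mult_H: "h \<in> H \<Longrightarrow> x \<in> carrier G \<Longrightarrow> H #> (h \<otimes> x) = H #> x"
  using coset_mult_assoc[OF subgroup.subset[OF subgroup] H_closed, of h x]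
    subgroup.rcos_const[OF subgroup is_group, of h] by simp

text \<open>Left translation is the restriction of multiplication to a slice \<open>{g} \<times> G\<close>.\<close>

lemma left_mult_morphism:
  assumes g: "g \<in> carrier G"
  shows "morphism (var G) (var G) (\<lambda>x. g \<otimes> x)"
proof (rule morphismI)
  show "g \<otimes> x \<in> carrier (var G)" if "x \<in> carrier (var G)" for x
    using that g by (simp add: var_def)
  show "(\<lambda>x. f (g \<otimes> x)) \<in> reg (var G)" if f: "f \<in> reg (var G)" for f
  proof -
    let ?P = "prod_alg_set (var G) (var G)" and ?V = "var G"
    have "(\<lambda>z. f (case z of (x, y) \<Rightarrow> x \<otimes> y)) \<in> reg ?P"
      using affine_group f by (intro morphism_regular[of ?P ?V]) (simp_all add: affine_alg_group_def)
    then have "(\<lambda>z. f (case z of (x, y) \<Rightarrow> x \<otimes> y)) \<in> fun_alg (carrier ?V \<times> carrier ?V)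
        ({f \<circ> fst | f. f \<in> reg ?V} \<union> {g \<circ> snd | g. g \<in> reg ?V})"
      by (simp add: prod_alg_set_def)
    then have "(\<lambda>x. f (case (g, x) of (x, y) \<Rightarrow> x \<otimes> y)) \<in> reg ?V"
    proof (rule G.fun_alg_compose)
      show "(g, x) \<in> carrier ?V \<times> carrier ?V" if "x \<in> carrier ?V" for x
        using that g by (simp add: var_def)
      show "(\<lambda>x. u (g, x)) \<in> reg ?V"
        if "u \<in> {f \<circ> fst | f. f \<in> reg ?V} \<union> {g \<circ> snd | g. g \<in> reg ?V}" for u
        using that G.const by auto
    qed
    then show ?thesis by simp
  qed
qed

lemma coset_morphism: "morphism (var G) (var Q) (\<lambda>x. H #> x)"
  by (rule morphismI) (auto simp: var_def coset_closed quotient_group_def quotient_alg_set_def comp_def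
      FactGroup_def RCOSETS_def)

text \<open>Averaging over \<open>H\<close> up to the factor \<open>card H\<close>, with values on cosets: \<open>coset_sum f\<close> pulls back to the
sum of the left translates of \<open>f\<close> by \<open>H\<close>.\<close>

definition coset_sum :: "('a \<Rightarrow> complex) \<Rightarrow> 'a set \<Rightarrow> complex" where
  "coset_sum f C = (\<Sum>z\<in>C. f z)"

lemma coset_sum_coset:
  assumes "x \<in> carrier G"
  shows "coset_sum f (H #> x) = (\<Sum>h\<in>H. f (h \<otimes> x))"
proof -
  have "inj_on (\<lambda>h. h \<otimes> x) H"
    using assms H_closed by (intro inj_onI) auto
  moreover have "H #> x = (\<lambda>h. h \<otimes> x) ` H" by (auto simp: r_coset_def)
  ultimately show ?thesis by (simp add: coset_sum_def sum.reindex)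
qed

lemma coset_sum_regular:
  assumes "f \<in> reg (var G)"
  shows "coset_sum f \<in> reg (var Q)"
proof -
  have "(\<lambda>x. \<Sum>h\<in>H. f (h \<otimes> x)) \<in> reg (var G)"
    by (intro G.sum morphism_regular[OF left_mult_morphism] H_closed assms)
  then have "(\<lambda>x. coset_sum f (H #> x)) \<in> reg (var G)"
    by (rule G.reg_cong) (simp add: coset_sum_coset var_def)
  then show ?thesis
    by (simp add: var_def quotient_group_def quotient_alg_set_def comp_def)
qed

lemma hom_free_carrier: "carrier (hom_free N G) = {..<N} \<rightarrow>\<^sub>E carrier G"
  by (simp add: hom_free_def power_alg_set_def var_def)

lemma mult_tuple_morphism:
  "\<sigma> \<in> {..<N} \<rightarrow>\<^sub>E H \<Longrightarrow> morphism (hom_free N G) (hom_free N G) (mult_tuple N G \<sigma>)"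
  unfolding hom_free_def mult_tuple_def
  by (rule power_morphism, rule left_mult_morphism, rule H_closed) auto

lemma proj_tuple_morphism: "morphism (hom_free N G) (hom_free N Q) (proj_tuple N G H)"
  unfolding hom_free_def proj_tuple_def by (rule power_morphism[OF coset_morphism])

lemma proj_tuple_surjective:
  assumes "y \<in> carrier (hom_free N Q)"
  obtains \<rho> where "\<rho> \<in> carrier (hom_free N G)" "proj_tuple N G H \<rho> = y"
proof -
  have y: "y \<in> {..<N} \<rightarrow>\<^sub>E carrier Q"
    using assms by (simp add: hom_free_def power_alg_set_def var_def)
  then have "\<exists>x. x \<in> carrier G \<and> y i = H #> x" if "i < N" for i
    using coset_cases[of "y i"] that by (metis PiE_mem lessThan_iff)
  then obtain r where r: "\<And>i. i < N \<Longrightarrow> r i \<in> carrier G \<and> y i = H #> r i" by metis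
  show ?thesis
  proof
    show "restrict r {..<N} \<in> carrier (hom_free N G)" using r by (simp add: hom_free_carrier)
    show "proj_tuple N G H (restrict r {..<N}) = y"
      using r y by (auto simp: proj_tuple_def fun_eq_iff PiE_iff extensional_def)
  qed
qed

lemma proj_tuple_mult_tuple:
  assumes "\<sigma> \<in> {..<N} \<rightarrow>\<^sub>E H" "\<rho> \<in> carrier (hom_free N G)"
  shows "proj_tuple N G H (mult_tuple N G \<sigma> \<rho>) = proj_tuple N G H \<rho>"
  using assms coset_mult_H
  by (auto simp: proj_tuple_def mult_tuple_def hom_free_carrier PiE_iff intro!: restrict_ext)

lemma proj_tuple_conj_tuple:
  assumes "g \<in> carrier G" "\<rho> \<in> carrier (hom_free N G)"
  shows "proj_tuple N G H (conj_tuple N G g \<rho>) = conj_tuple N Q (H #> g) (proj_tuple N G H \<rho>)"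
  using assms
  by (auto simp: proj_tuple_def conj_tuple_def hom_free_carrier PiE_iff coset_inv coset_mult
      intro!: restrict_ext)

text \<open>Centrality of \<open>H\<close> is what makes translations by tuples in \<open>H\<close> commute with conjugation, so that
they act on the character variety.\<close>

lemma mult_tuple_conj_tuple:
  assumes "\<sigma> \<in> {..<N} \<rightarrow>\<^sub>E H" "g \<in> carrier G" "\<rho> \<in> carrier (hom_free N G)"
  shows "mult_tuple N G \<sigma> (conj_tuple N G g \<rho>) = conj_tuple N G g (mult_tuple N G \<sigma> \<rho>)"
proof -
  have "\<sigma> i \<otimes> (g \<otimes> \<rho> i \<otimes> inv g) = g \<otimes> (\<sigma> i \<otimes> \<rho> i) \<otimes> inv g" if "i < N" for i
  proof -
    have "\<sigma> i \<in> H" "\<rho> i \<in> carrier G"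
      using assms that by (auto simp: hom_free_carrier)
    then show ?thesis
      using assms(2) central[of "\<sigma> i" g] H_closed by (simp add: m_assoc[symmetric])
  qed
  then show ?thesis by (auto simp: mult_tuple_def conj_tuple_def intro!: restrict_ext)
qed

text \<open>On a pure tensor, the sum over \<open>H\<^sup>N\<close> is the product of the sums over \<open>H\<close> in each coordinate, and
each of these is a function of the coset of that coordinate.\<close>

lemma sum_over_tuples_descends:
  assumes "F \<in> reg (hom_free N G)"
  shows "\<exists>F'\<in>reg (hom_free N Q). \<forall>\<rho>\<in>carrier (hom_free N G).
    F' (proj_tuple N G H \<rho>) = (\<Sum>\<sigma>\<in>{..<N} \<rightarrow>\<^sub>E H. F (mult_tuple N G \<sigma> \<rho>))"
proof -
  interpret R: function_algebra "hom_free N Q"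
    unfolding hom_free_def by (rule power_function_algebra)
  have "F \<in> tensor_span N (var G)"
    using assms unfolding hom_free_def by (rule G.power_regular_in_tensor_span)
  then show ?thesis
  proof induction
    case (pure f c)
    let ?F' = "\<lambda>y. c * (\<Prod>i<N. coset_sum (f i) (y i))"
    have "(\<lambda>y. coset_sum (f i) (y i)) \<in> reg (hom_free N Q)" if "i < N" for i
      unfolding hom_free_def by (rule power_coordinate_regular[OF coset_sum_regular[OF pure[OF that]] that])
    then have reg: "?F' \<in> reg (hom_free N Q)"
      by (intro R.scale R.prod[of "{..<N}" "\<lambda>i y. coset_sum (f i) (y i)"]) simp
    have eq: "?F' (proj_tuple N G H \<rho>) =
        (\<Sum>\<sigma>\<in>{..<N} \<rightarrow>\<^sub>E H. c * (\<Prod>i<N. f i (mult_tuple N G \<sigma> \<rho> i)))"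
      if "\<rho> \<in> carrier (hom_free N G)" for \<rho>
    proof -
      have "(\<Prod>i<N. coset_sum (f i) (proj_tuple N G H \<rho> i)) = (\<Prod>i<N. \<Sum>h\<in>H. f i (h \<otimes> \<rho> i))"
        using that by (intro prod.cong)
          (auto simp: proj_tuple_def hom_free_carrier PiE_iff coset_sum_coset)
      also have "\<dots> = (\<Sum>\<sigma>\<in>{..<N} \<rightarrow>\<^sub>E H. \<Prod>i<N. f i (\<sigma> i \<otimes> \<rho> i))"
        using finite by (intro prod_sum_PiE) auto
      finally show ?thesis by (simp add: mult_tuple_def sum_distrib_left)
    qed
    show ?case by (rule bexI[OF _ reg], rule ballI, rule eq)
  next
    case (add F1 F2)
    then obtain F1' F2' where
      "F1' \<in> reg (hom_free N Q)" "F2' \<in> reg (hom_free N Q)" and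
      eq: "\<forall>\<rho>\<in>carrier (hom_free N G).
        F1' (proj_tuple N G H \<rho>) = (\<Sum>\<sigma>\<in>{..<N} \<rightarrow>\<^sub>E H. F1 (mult_tuple N G \<sigma> \<rho>))"
      "\<forall>\<rho>\<in>carrier (hom_free N G).
        F2' (proj_tuple N G H \<rho>) = (\<Sum>\<sigma>\<in>{..<N} \<rightarrow>\<^sub>E H. F2 (mult_tuple N G \<sigma> \<rho>))"
      by blast
    then show ?case
      by (intro bexI[OF _ R.add[of F1' F2']]) (auto simp: sum.distrib)
  next
    case (cong F1 F2)
    have "F2 (mult_tuple N G \<sigma> \<rho>) = F1 (mult_tuple N G \<sigma> \<rho>)"
      if "\<sigma> \<in> {..<N} \<rightarrow>\<^sub>E H" "\<rho> \<in> carrier (hom_free N G)" for \<sigma> \<rho>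
      using cong.hyps(2) morphism_closed[OF mult_tuple_morphism[OF that(1)] that(2)]
      by (simp add: hom_free_carrier var_def)
    then show ?case using cong.IH by simp
  qed
qed

text \<open>Hence the coordinate ring of \<open>(G/H)\<^sup>N\<close>, which is defined by generators in each coordinate, is all of
the ring of \<open>H\<^sup>N\<close>-invariants on \<open>G\<^sup>N\<close>: an invariant function is its own average.\<close>

lemma translation_invariant_descends:
  assumes F: "F \<in> reg (hom_free N G)"
    and inv: "\<And>\<sigma> \<rho>. \<sigma> \<in> {..<N} \<rightarrow>\<^sub>E H \<Longrightarrow> \<rho> \<in> carrier (hom_free N G)
      \<Longrightarrow> F (mult_tuple N G \<sigma> \<rho>) = F \<rho>"
  obtains F' where "F' \<in> reg (hom_free N Q)"
    "\<And>\<rho>. \<rho> \<in> carrier (hom_free N G) \<Longrightarrow> F' (proj_tuple N G H \<rho>) = F \<rho>"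
proof -
  interpret R: function_algebra "hom_free N Q"
    unfolding hom_free_def by (rule power_function_algebra)
  let ?T = "{..<N} \<rightarrow>\<^sub>E H"
  obtain F' where F': "F' \<in> reg (hom_free N Q)" "\<forall>\<rho>\<in>carrier (hom_free N G).
    F' (proj_tuple N G H \<rho>) = (\<Sum>\<sigma>\<in>?T. F (mult_tuple N G \<sigma> \<rho>))"
    using sum_over_tuples_descends[OF F] by blast
  have "card ?T \<noteq> 0"
    using finite subgroup.one_closed[OF subgroup] by (auto simp: card_PiE)
  then have "inverse (of_nat (card ?T)) * F' (proj_tuple N G H \<rho>) = F \<rho>"
    if "\<rho> \<in> carrier (hom_free N G)" for \<rho>
    using F'(2) inv that by simp
  then show ?thesis using that R.scale[OF F'(1)] by blast
qed

end


section \<open>The induced isomorphism of character varieties\<close>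

locale character_variety_quotient = finite_central_subgroup G H
  for G :: "'a alg_group" (structure) and H :: "'a set" +
  fixes N :: nat and X :: "'x alg_set" and \<pi> :: "(nat \<Rightarrow> 'a) \<Rightarrow> 'x"
    and Y :: "'y alg_set" and \<pi>' :: "(nat \<Rightarrow> 'a set) \<Rightarrow> 'y"
  assumes X: "character_variety N G X \<pi>" and Y: "character_variety N (quotient_group G H) Y \<pi>'"
begin

text \<open>\<open>T\<close> is the finite group \<open>H\<^sup>N\<close>. The letters \<open>RG\<close> and \<open>RQ\<close> stand for the sets of representations
in \<open>G\<close> and in \<open>G/H\<close>.\<close>

abbreviation T where "T \<equiv> product_group {..<N} (\<lambda>_. G\<lparr>carrier := H\<rparr>)"
abbreviation act where "act \<equiv> char_act N G X \<pi>"
abbreviation translate where "translate \<equiv> mult_tuple N G"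
abbreviation pr where "pr \<equiv> proj_tuple N G H"
abbreviation RG where "RG \<equiv> hom_free N G"
abbreviation RQ where "RQ \<equiv> hom_free N Q"

lemma RG_algebra: "function_algebra RG" and RQ_algebra: "function_algebra RQ"
  unfolding hom_free_def by (rule power_function_algebra)+

lemma X_quotient: "categorical_quotient (carrier G) (conj_tuple N G) RG X \<pi>"
  and Y_quotient: "categorical_quotient (carrier Q) (conj_tuple N Q) RQ Y \<pi>'"
  using X Y by (simp_all add: character_variety_def)

lemma X_affine: "affine_alg_set X" and pi_morphism: "morphism RG X \<pi>"
  and pi_invariant: "invariant_on (carrier G) (conj_tuple N G) (carrier RG) \<pi>"
  using X_quotient by (simp_all add: categorical_quotient_def)

lemma Y_affine: "affine_alg_set Y" and pi'_morphism: "morphism RQ Y \<pi>'"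
  and pi'_invariant: "invariant_on (carrier Q) (conj_tuple N Q) (carrier RQ) \<pi>'"
  using Y_quotient by (simp_all add: categorical_quotient_def)

lemmas X_morphism_eq = categorical_quotient_morphism_eq[OF X_quotient RG_algebra]

lemma T_carrier: "carrier T = {..<N} \<rightarrow>\<^sub>E H"
  by simp

lemma T_group: "group T"
  by (rule product_group) (rule subgroup.subgroup_is_group[OF subgroup is_group])

lemma translate_closed: "\<sigma> \<in> carrier T \<Longrightarrow> \<rho> \<in> carrier RG \<Longrightarrow> translate \<sigma> \<rho> \<in> carrier RG"
  using morphism_closed[OF mult_tuple_morphism] T_carrier by blast

lemma translate_mult:
  assumes "\<sigma> \<in> carrier T" "\<tau> \<in> carrier T" "\<rho> \<in> carrier RG"
  shows "translate (\<sigma> \<otimes>\<^bsub>T\<^esub> \<tau>) \<rho> = translate \<sigma> (translate \<tau> \<rho>)"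
  using assms H_closed
  by (auto simp: mult_tuple_def hom_free_carrier PiE_iff m_assoc intro!: restrict_ext)

lemma translate_one:
  assumes "\<rho> \<in> carrier RG"
  shows "translate \<one>\<^bsub>T\<^esub> \<rho> = \<rho>"
  using assms by (auto simp: mult_tuple_def hom_free_carrier PiE_iff fun_eq_iff extensional_def)

text \<open>The definite description in \<open>char_act\<close> is justified by the universal property of \<open>\<pi>\<close>, since
\<open>\<pi> \<circ> translate \<sigma>\<close> is conjugation invariant.\<close>

lemma act_induced:
  assumes "\<sigma> \<in> carrier T"
  shows "induced RG \<pi> X \<pi> X (translate \<sigma>) (act \<sigma>)"
  unfolding char_act_def
proof (rule theI'[where P = "induced RG \<pi> X \<pi> X (translate \<sigma>)"])
  have \<sigma>: "\<sigma> \<in> {..<N} \<rightarrow>\<^sub>E H" using assms by simp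
  have "invariant_on (carrier G) (conj_tuple N G) (carrier RG) (\<lambda>\<rho>. \<pi> (translate \<sigma> \<rho>))"
    using pi_invariant translate_closed[OF assms] mult_tuple_conj_tuple[OF \<sigma>]
    unfolding invariant_on_def by simp
  then obtain h where "h \<in> extensional (carrier X)" "morphism X X h"
    "\<And>\<rho>. \<rho> \<in> carrier RG \<Longrightarrow> h (\<pi> \<rho>) = \<pi> (translate \<sigma> \<rho>)"
    using categorical_quotient_morphism_lift[OF X_quotient X_affine
        morphism_compose[OF mult_tuple_morphism[OF \<sigma>] pi_morphism]] by blast
  then have "induced RG \<pi> X \<pi> X (translate \<sigma>) h" by (simp add: induced_def)
  moreover have "h1 = h2" if "induced RG \<pi> X \<pi> X (translate \<sigma>) h1" "induced RG \<pi> X \<pi> X (translate \<sigma>) h2"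
    for h1 h2
    using that X_morphism_eq[OF X_affine, of h1 h2]
    by (intro extensionalityI[of _ "carrier X"]) (auto simp: induced_def)
  ultimately show "\<exists>!h. induced RG \<pi> X \<pi> X (translate \<sigma>) h" by blast
qed

lemma act_pi: "\<sigma> \<in> carrier T \<Longrightarrow> \<rho> \<in> carrier RG \<Longrightarrow> act \<sigma> (\<pi> \<rho>) = \<pi> (translate \<sigma> \<rho>)"
  and act_morphism: "\<sigma> \<in> carrier T \<Longrightarrow> morphism X X (act \<sigma>)"
  using act_induced by (auto simp: induced_def)

text \<open>The laws of an action hold for the translations of representations, and they pass to \<open>X\<close> because
morphisms on \<open>X\<close> that agree after composition with \<open>\<pi>\<close> are equal.\<close>

lemma act_action: "finite_group_action T X act"
proof -
  interpret T: group T by (rule T_group)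
  show ?thesis
  proof unfold_locales
    show "finite (carrier T)" unfolding T_carrier by (intro finite_PiE finite) auto
    show "affine_alg_set X" by (rule X_affine)
    show "morphism X X (act \<sigma>)" if "\<sigma> \<in> carrier T" for \<sigma> using that by (rule act_morphism)
    show "act \<one>\<^bsub>T\<^esub> x = x" if x: "x \<in> carrier X" for x
    proof (rule X_morphism_eq[OF X_affine act_morphism[OF T.one_closed] _ _ x, of "\<lambda>x. x"])
      show "morphism X X (\<lambda>x. x)" by (rule morphismI)
    qed (simp only: act_pi T.one_closed translate_one)
    show "act (\<sigma> \<otimes>\<^bsub>T\<^esub> \<tau>) x = act \<sigma> (act \<tau> x)"
      if st: "\<sigma> \<in> carrier T" "\<tau> \<in> carrier T" and x: "x \<in> carrier X" for \<sigma> \<tau> x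
      by (rule X_morphism_eq[OF X_affine act_morphism[OF T.m_closed[OF st]]
            morphism_compose[OF act_morphism[OF st(2)] act_morphism[OF st(1)]] _ x])
         (simp only: act_pi T.m_closed st translate_mult translate_closed)
  qed
qed

text \<open>An \<open>H\<^sup>N\<close>-invariant function on \<open>X\<close> is a function on \<open>G\<^sup>N\<close> invariant under both \<open>H\<^sup>N\<close> and
conjugation. By the first invariance it comes from \<open>(G/H)\<^sup>N\<close>. By the second, and since all cosets and
all tuples of cosets have representatives, it is conjugation invariant there and comes from \<open>Y\<close>.\<close>

lemma invariant_function_descends:
  assumes f: "f \<in> reg X" and inv: "invariant_on (carrier T) act (carrier X) f"
  shows "\<exists>g\<in>reg Y. \<forall>\<rho>\<in>carrier RG. g (\<pi>' (pr \<rho>)) = f (\<pi> \<rho>)"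
proof -
  have "f (\<pi> (translate \<sigma> \<rho>)) = f (\<pi> \<rho>)" if "\<sigma> \<in> {..<N} \<rightarrow>\<^sub>E H" "\<rho> \<in> carrier RG" for \<sigma> \<rho>
    using that inv act_pi[of \<sigma> \<rho>] morphism_closed[OF pi_morphism]
    unfolding invariant_on_def T_carrier by metis
  then obtain F where F: "F \<in> reg RQ" "\<And>\<rho>. \<rho> \<in> carrier RG \<Longrightarrow> F (pr \<rho>) = f (\<pi> \<rho>)"
    using translation_invariant_descends[OF morphism_regular[OF pi_morphism f]] by blast
  have "invariant_on (carrier Q) (conj_tuple N Q) (carrier RQ) F"
    unfolding invariant_on_def
  proof (intro ballI)
    fix C y assume "C \<in> carrier Q" "y \<in> carrier RQ"
    then obtain g \<rho> where g: "g \<in> carrier G" "C = H #> g" and \<rho>: "\<rho> \<in> carrier RG" "pr \<rho> = y"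
      by (metis coset_cases proj_tuple_surjective)
    have "conj_tuple N G g \<rho> \<in> carrier RG"
      using g(1) \<rho>(1) by (auto simp: conj_tuple_def hom_free_carrier)
    then have "F (pr (conj_tuple N G g \<rho>)) = F (pr \<rho>)"
      using F(2) pi_invariant g(1) \<rho>(1) unfolding invariant_on_def by simp
    then show "F (conj_tuple N Q C y) = F y"
      using proj_tuple_conj_tuple[OF g(1) \<rho>(1)] g(2) \<rho>(2) by simp
  qed
  then obtain g where "g \<in> reg Y" "\<And>y. y \<in> carrier RQ \<Longrightarrow> g (\<pi>' y) = F y"
    using categorical_quotient_function_lift[OF Y_quotient RQ_algebra F(1)] by blast
  then show ?thesis
    using F(2) morphism_closed[OF proj_tuple_morphism] by (intro bexI[of _ g]) auto
qed

lemma induced_map_exists: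
  obtains h where "morphism X Y h" "\<And>\<rho>. \<rho> \<in> carrier RG \<Longrightarrow> h (\<pi> \<rho>) = \<pi>' (pr \<rho>)"
proof -
  have "invariant_on (carrier G) (conj_tuple N G) (carrier RG) (\<lambda>\<rho>. \<pi>' (pr \<rho>))"
    using pi'_invariant coset_closed morphism_closed[OF proj_tuple_morphism]
    unfolding invariant_on_def by (simp add: proj_tuple_conj_tuple)
  then show ?thesis
    using categorical_quotient_morphism_lift[OF X_quotient Y_affine
        morphism_compose[OF proj_tuple_morphism pi'_morphism]] that by blast
qed

text \<open>All three properties can be checked on representations: functions and morphisms on \<open>X\<close> and on \<open>Y\<close>
are determined by their pullbacks along \<open>\<pi>\<close> and \<open>\<pi>'\<close>, and every representation in \<open>G/H\<close> lifts to
\<open>G\<close> because the source group is free.\<close>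

lemma induced_map_is_finite_quotient:
  assumes h: "morphism X Y h" "\<And>\<rho>. \<rho> \<in> carrier RG \<Longrightarrow> h (\<pi> \<rho>) = \<pi>' (pr \<rho>)"
  shows "finite_quotient_map T X act Y h"
proof -
  interpret finite_group_action T X act by (rule act_action)
  show ?thesis
  proof unfold_locales
    show "h (act \<sigma> x) = h x" if \<sigma>: "\<sigma> \<in> carrier T" and x: "x \<in> carrier X" for \<sigma> x
    proof (rule X_morphism_eq[OF Y_affine morphism_compose[OF act_morphism[OF \<sigma>] h(1)] h(1) _ x])
      fix \<rho> assume "\<rho> \<in> carrier RG"
      then show "h (act \<sigma> (\<pi> \<rho>)) = h (\<pi> \<rho>)"
        using \<sigma> act_pi[OF \<sigma>] translate_closed[OF \<sigma>] h(2) proj_tuple_mult_tuple[of \<sigma> N \<rho>] by simp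
    qed
    show "\<exists>g\<in>reg Y. \<forall>x\<in>carrier X. g (h x) = f x"
      if f: "f \<in> reg X" "invariant_on (carrier T) act (carrier X) f" for f
    proof -
      obtain g where g: "g \<in> reg Y" "\<forall>\<rho>\<in>carrier RG. g (\<pi>' (pr \<rho>)) = f (\<pi> \<rho>)"
        using invariant_function_descends[OF f] by blast
      have "g (h x) = f x" if "x \<in> carrier X" for x
        by (rule categorical_quotient_function_eq[OF X_quotient RG_algebra
              morphism_regular[OF h(1) g(1)] f(1) _ that]) (simp add: h(2) g(2))
      then show ?thesis using g(1) by blast
    qed
    show "g y = 0" if g: "g \<in> reg Y" "\<forall>x\<in>carrier X. g (h x) = 0" and y: "y \<in> carrier Y" for g y
    proof (rule categorical_quotient_function_eq[OF Y_quotient RQ_algebra g(1) _ _ y, of "\<lambda>_. 0"])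
      show "(\<lambda>_. 0) \<in> reg Y"
        by (rule function_algebra.const[OF affine_function_algebra[OF Y_affine]])
      fix z assume "z \<in> carrier RQ"
      then obtain \<rho> where "\<rho> \<in> carrier RG" "pr \<rho> = z" by (rule proj_tuple_surjective)
      then show "g (\<pi>' z) = 0" using g(2) h(2) morphism_closed[OF pi_morphism] by metis
    qed
  qed (fact Y_affine h(1))+
qed

abbreviation orbit where "orbit \<equiv> char_orbit N G H X \<pi>"
abbreviation orbit_space where "orbit_space \<equiv> char_orbit_space N G H X \<pi>"

lemma induced_unique:
  assumes "induced RG (orbit \<circ> \<pi>) orbit_space \<pi>' Y pr \<phi>"
    and "induced RG (orbit \<circ> \<pi>) orbit_space \<pi>' Y pr \<psi>"
  shows "\<phi> = \<psi>"
proof (rule extensionalityI)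
  show "\<phi> \<in> extensional (carrier orbit_space)" "\<psi> \<in> extensional (carrier orbit_space)"
    using assms by (simp_all add: induced_def)
  have orbit: "morphism X orbit_space orbit"
    by (rule morphismI) (auto simp: char_orbit_space_def quotient_alg_set_def comp_def)
  have "morphism X Y (\<lambda>x. \<phi> (orbit x))" "morphism X Y (\<lambda>x. \<psi> (orbit x))"
    using assms morphism_compose[OF orbit] by (auto simp: induced_def)
  then have "\<phi> (orbit x) = \<psi> (orbit x)" if "x \<in> carrier X" for x
    by (rule X_morphism_eq[OF Y_affine]) (use that assms in \<open>auto simp: induced_def\<close>)
  then show "\<phi> c = \<psi> c" if "c \<in> carrier orbit_space" for c
    using that by (auto simp: char_orbit_space_def quotient_alg_set_def)
qed

lemma induced_isomorphism_exists:
  "\<exists>\<psi>. induced RG (orbit \<circ> \<pi>) orbit_space \<pi>' Y pr \<psi> \<and> isomorphism orbit_space Y \<psi>"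
proof -
  obtain h where h: "morphism X Y h" "\<And>\<rho>. \<rho> \<in> carrier RG \<Longrightarrow> h (\<pi> \<rho>) = \<pi>' (pr \<rho>)"
    using induced_map_exists by blast
  interpret finite_quotient_map T X act Y h
    by (rule induced_map_is_finite_quotient[OF h])
  obtain \<psi> where "\<psi> \<in> extensional (carrier orbit_space)"
    "\<And>x. x \<in> carrier X \<Longrightarrow> \<psi> (orbit x) = h x" "isomorphism orbit_space Y \<psi>"
    using orbit_space_isomorphism[of orbit] unfolding char_orbit_space_def char_orbit_def T_carrier
    by blast
  then show ?thesis
    using h(2) morphism_closed[OF pi_morphism] by (auto simp: induced_def isomorphism_def)
qed

end

theorem proposition6:
  fixes G :: "'a alg_group" and H :: "'a set" and N :: nat
    and X :: "'x alg_set" and \<pi> :: "(nat \<Rightarrow> 'a) \<Rightarrow> 'x"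
    and Y :: "'y alg_set" and \<pi>' :: "(nat \<Rightarrow> 'a set) \<Rightarrow> 'y"
  assumes "reductive_group G"
    and "subgroup H G" and "finite H"
    and "\<forall>h\<in>H. \<forall>g\<in>carrier G. h \<otimes>\<^bsub>G\<^esub> g = g \<otimes>\<^bsub>G\<^esub> h"
    and "character_variety N G X \<pi>"
    and "character_variety N (quotient_group G H) Y \<pi>'"
  shows "\<exists>\<psi>. induced (hom_free N G) (char_orbit N G H X \<pi> \<circ> \<pi>) (char_orbit_space N G H X \<pi>)
               \<pi>' Y (proj_tuple N G H) \<psi> \<and>
             (\<forall>\<phi>. induced (hom_free N G) (char_orbit N G H X \<pi> \<circ> \<pi>) (char_orbit_space N G H X \<pi>)
               \<pi>' Y (proj_tuple N G H) \<phi> \<longrightarrow> \<phi> = \<psi>) \<and>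
             isomorphism (char_orbit_space N G H X \<pi>) Y \<psi>"
proof -
  interpret character_variety_quotient G H N X \<pi> Y \<pi>'
    by (intro character_variety_quotient.intro character_variety_quotient_axioms.intro
        finite_central_subgroup.intro) (use assms in \<open>auto simp: reductive_group_def\<close>)
  show ?thesis
    using induced_isomorphism_exists induced_unique by blast
qed

end
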